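(* The following two statements are equivalent. (A) (Charney--Davis Conjecture) For every integer $d\ge 1$ and every flag simplicial complex $L$ that is a generalized homology sphere of dimension $2d-1$, one has $(-1)^d h_L(-1)\ge 0$. (B) For every integer $d\ge 1$ and every flag simplicial complex $L$ that is a generalized homology sphere of dimension $2d$, if $\widetilde h_L(t)$ denotes the polynomial defined by $h_L(t)=(1+t)\,\widetilde h_L(t)$, then $(-1)^d\,\widetilde h_L(-1)\ge 0$.
   Context: All simplicial complexes are finite, and the empty set is counted as a simplex. For a simplex $\sigma$, $|\sigma|$ denotes its number of vertices, so $\dim\sigma=|\sigma|-1$. A simplicial complex $L$ is flag if every finite nonempty set of vertices of $L$ that are pairwise joined by edges of $L$ spans a simplex of $L$. The link of a simplex $\sigma$ in $L$ is $\mathrm{Lk}_\sigma=\{\tau\in L:\tau\cap\sigma=\emptyset,\ \tau\cup\sigma\in L\}$; in particular $\mathrm{Lk}_\emptyset=L$. A generalized homology sphere of dimension $m$ is an $m$-dimensional simplicial complex $L$ such that for every simplex $\sigma$ of $L$ (including $\sigma=\emptyset$), $\mathrm{Lk}_\sigma$ has dimension $m-|\sigma|$ and the same (reduced) integral homology as the sphere $S^{m-|\sigma|}$, where $S^{-1}=\emptyset$, corresponding to the complex $\{\emptyset\}$ of dimension $-1$. The f-polynomial of $L$ is $f_L(t)=\sum_{\sigma\in L}t^{|\sigma|}$, the sum being over all simplices including the empty one. If $L$ has dimension $n-1$, the h-polynomial $h_L(t)$ is the polynomial determined by $$(1+t)^n\,h_L\!\left(\frac{1}{1+t}\right)=t^n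 f_L\!\left(\frac1t\right),$$ equivalently $h_L(t)=(1-t)^n f_L\!\left(\frac{t}{1-t}\right)$. For a generalized homology sphere $L$ of dimension $2d$, the Dehn--Sommerville relations $h_L(t)=t^{2d+1}h_L(1/t)$ give $h_L(-1)=0$, so $h_L(t)$ is divisible by $1+t$ and $\widetilde h_L(t)$ in (B) is a well-defined polynomial. *)

theory Defs
  imports
    "HOL-Homology.Homology"
    "HOL-Computational_Algebra.Polynomial"
    "HOL-Library.Infinite_Typeclass"
begin

section \<open>Finite simplicial complexes\<close>

text \<open>
  A vertex is an element of \<open>\<Union>L\<close>. Every finite simplicial complex has an isomorphic copy on any given
  type of class \<open>infinite\<close>, so quantifying over the complexes on such a type loses nothing.
\<close>

definition simplicial_complex :: "'a set set \<Rightarrow> bool" where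
  "simplicial_complex L \<longleftrightarrow>
     finite L \<and> {} \<in> L \<and> (\<forall>\<sigma>\<in>L. finite \<sigma> \<and> (\<forall>\<tau>. \<tau> \<subseteq> \<sigma> \<longrightarrow> \<tau> \<in> L))"

text \<open>An integer, since the complex whose only simplex is the empty one has dimension \<open>-1\<close>.\<close>

definition simplicial_dim :: "'a set set \<Rightarrow> int" where
  "simplicial_dim L = Max ((\<lambda>\<sigma>. int (card \<sigma>) - 1) ` L)"

definition flag_complex :: "'a set set \<Rightarrow> bool" where
  "flag_complex L \<longleftrightarrow>
     simplicial_complex L \<and>
     (\<forall>S. finite S \<and> S \<noteq> {} \<and> S \<subseteq> \<Union>L \<and> (\<forall>u\<in>S. \<forall>v\<in>S. u \<noteq> v \<longrightarrow> {u, v} \<in> L) \<longrightarrow> S \<in> L)"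

definition link :: "'a set set \<Rightarrow> 'a set \<Rightarrow> 'a set set" where
  "link L \<sigma> = {\<tau> \<in> L. \<tau> \<inter> \<sigma> = {} \<and> \<tau> \<union> \<sigma> \<in> L}"

section \<open>Reduced simplicial homology with integer coefficients\<close>

text \<open>
  An oriented \<open>i\<close>-chain is an integer-valued function on the orderings of the \<open>i\<close>-simplices that
  changes sign under odd permutations; adjacent transpositions suffice to say so. An ordering of
  \<open>\<sigma>\<close> is a distinct list \<open>xs\<close> with \<open>set xs = \<sigma>\<close>, and the value of a chain at \<open>xs\<close> is its coefficient
  at the oriented simplex \<open>[xs]\<close>. The empty simplex, with its only ordering \<open>[]\<close>, sits in degree
  \<open>-1\<close>, so the complex is the augmented one. No linear order on the vertices is needed.
\<close>

definition oriented_chains :: "int \<Rightarrow> 'a set set \<Rightarrow> ('a list \<Rightarrow> int) set" where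
  "oriented_chains i L =
     {c. (\<forall>xs. c xs \<noteq> 0 \<longrightarrow> distinct xs \<and> set xs \<in> L \<and> int (length xs) = i + 1) \<and>
         (\<forall>xs x y ys. c (xs @ y # x # ys) = - c (xs @ x # y # ys))}"

definition oriented_chain_group :: "int \<Rightarrow> 'a set set \<Rightarrow> ('a list \<Rightarrow> int) monoid" where
  "oriented_chain_group i L =
     \<lparr>carrier = oriented_chains i L, monoid.mult = (\<lambda>c d xs. c xs + d xs), monoid.one = (\<lambda>xs. 0)\<rparr>"

text \<open>
  The usual formula \<open>\<partial>[v\<^sub>0, \<dots>, v\<^sub>i] = \<Sum>\<^sub>j (-1)\<^sup>j [v\<^sub>0, \<dots>, (omit v\<^sub>j), \<dots>, v\<^sub>i]\<close>, read off at the
  oriented simplex \<open>[xs]\<close>: the oriented simplex \<open>[v # xs]\<close> has \<open>[xs]\<close> in its boundary with sign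
  \<open>+1\<close>, and each simplex having \<open>set xs\<close> as a facet is \<open>set (v # xs)\<close> for a single \<open>v\<close>.
\<close>

definition chain_boundary_map :: "'a set set \<Rightarrow> ('a list \<Rightarrow> int) \<Rightarrow> 'a list \<Rightarrow> int" where
  "chain_boundary_map L c xs = (\<Sum>v\<in>\<Union>L. c (v # xs))"

definition simplicial_cycles :: "int \<Rightarrow> 'a set set \<Rightarrow> ('a list \<Rightarrow> int) set" where
  "simplicial_cycles i L =
     kernel (oriented_chain_group i L) (oriented_chain_group (i - 1) L) (chain_boundary_map L)"

definition simplicial_boundaries :: "int \<Rightarrow> 'a set set \<Rightarrow> ('a list \<Rightarrow> int) set" where
  "simplicial_boundaries i L = chain_boundary_map L ` oriented_chains (i + 1) L"

definition reduced_simplicial_homology :: "int \<Rightarrow> 'a set set \<Rightarrow> ('a list \<Rightarrow> int) set monoid" where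
  "reduced_simplicial_homology i L =
     ((oriented_chain_group i L)\<lparr>carrier := simplicial_cycles i L\<rparr>) Mod simplicial_boundaries i L"

lemma chain_boundary_map_in_chains:
  assumes L: "simplicial_complex L" and c: "c \<in> oriented_chains i L"
  shows "chain_boundary_map L c \<in> oriented_chains (i - 1) L"
proof -
  have supp: "distinct xs \<and> set xs \<in> L \<and> int (length xs) = i - 1 + 1" if "chain_boundary_map L c xs \<noteq> 0" for xs
  proof -
    obtain v where "c (v # xs) \<noteq> 0"
      using \<open>chain_boundary_map L c xs \<noteq> 0\<close> unfolding chain_boundary_map_def
      by (meson sum.neutral)
    then have "distinct (v # xs)" "set (v # xs) \<in> L" "int (length (v # xs)) = i + 1"
      using c unfolding oriented_chains_def by blast+
    moreover have "set xs \<in> L"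
      using \<open>set (v # xs) \<in> L\<close> L unfolding simplicial_complex_def by (meson set_subset_Cons)
    ultimately show ?thesis by simp
  qed
  have "c (v # xs @ y # x # ys) = - c (v # xs @ x # y # ys)" for v xs x y ys
    using c unfolding oriented_chains_def mem_Collect_eq by (metis append_Cons)
  then have "chain_boundary_map L c (xs @ y # x # ys) = - chain_boundary_map L c (xs @ x # y # ys)"
    for xs x y ys
    unfolding chain_boundary_map_def sum_negf[symmetric] by (intro sum.cong refl)
  with supp show ?thesis
    unfolding oriented_chains_def by blast
qed

lemma chain_boundary_map_twice:
  assumes c: "c \<in> oriented_chains i L"
  shows "chain_boundary_map L (chain_boundary_map L c) = (\<lambda>xs. 0)"
proof
  fix xs
  have swap: "c (v # w # xs) = - c (w # v # xs)" for v w
    using c unfolding oriented_chains_def mem_Collect_eq by (metis append_Nil)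
  have "(\<Sum>w\<in>\<Union>L. \<Sum>v\<in>\<Union>L. c (v # w # xs)) = (\<Sum>v\<in>\<Union>L. \<Sum>w\<in>\<Union>L. c (v # w # xs))"
    by (rule sum.swap)
  also have "\<dots> = (\<Sum>v\<in>\<Union>L. \<Sum>w\<in>\<Union>L. - c (w # v # xs))"
    by (intro sum.cong refl) (rule swap)
  also have "\<dots> = - (\<Sum>w\<in>\<Union>L. \<Sum>v\<in>\<Union>L. c (v # w # xs))"
    by (simp add: sum_negf)
  finally show "chain_boundary_map L (chain_boundary_map L c) xs = 0"
    by (simp add: chain_boundary_map_def)
qed

lemma oriented_chains_closed:
  assumes "c \<in> oriented_chains i L" "d \<in> oriented_chains i L"
  shows "(\<lambda>xs. c xs + d xs) \<in> oriented_chains i L" "(\<lambda>xs. - c xs) \<in> oriented_chains i L"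
proof -
  have supp: "distinct xs \<and> set xs \<in> L \<and> int (length xs) = i + 1" if "c xs \<noteq> 0 \<or> d xs \<noteq> 0" for xs
    using assms that unfolding oriented_chains_def by blast
  have alt: "c (xs @ y # x # ys) = - c (xs @ x # y # ys)"
            "d (xs @ y # x # ys) = - d (xs @ x # y # ys)" for xs x y ys
    using assms unfolding oriented_chains_def by blast+
  have "c (xs @ y # x # ys) + d (xs @ y # x # ys) =
        - (c (xs @ x # y # ys) + d (xs @ x # y # ys))" for xs x y ys
    unfolding alt[of xs y x ys] by simp
  moreover have "distinct xs \<and> set xs \<in> L \<and> int (length xs) = i + 1" if "c xs + d xs \<noteq> 0" for xs
    using that by (intro supp) linarith
  ultimately show "(\<lambda>xs. c xs + d xs) \<in> oriented_chains i L"
    unfolding oriented_chains_def by blast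
  have "- c (xs @ y # x # ys) = - (- c (xs @ x # y # ys))" for xs x y ys
    unfolding alt(1)[of xs y x ys] by simp
  moreover have "distinct xs \<and> set xs \<in> L \<and> int (length xs) = i + 1" if "- c xs \<noteq> 0" for xs
    using that by (intro supp) linarith
  ultimately show "(\<lambda>xs. - c xs) \<in> oriented_chains i L"
    unfolding oriented_chains_def by blast
qed

lemma comm_group_oriented_chain_group: "comm_group (oriented_chain_group i L)"
proof (rule comm_groupI)
  show "\<one>\<^bsub>oriented_chain_group i L\<^esub> \<in> carrier (oriented_chain_group i L)"
    by (simp add: oriented_chain_group_def oriented_chains_def)
next
  fix c assume "c \<in> carrier (oriented_chain_group i L)"
  then have "(\<lambda>xs. - c xs) \<in> carrier (oriented_chain_group i L)"
    by (simp add: oriented_chain_group_def oriented_chains_closed)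
  then show "\<exists>d\<in>carrier (oriented_chain_group i L).
               d \<otimes>\<^bsub>oriented_chain_group i L\<^esub> c = \<one>\<^bsub>oriented_chain_group i L\<^esub>"
    by (rule rev_bexI) (simp add: oriented_chain_group_def)
qed (simp_all add: oriented_chain_group_def oriented_chains_closed add_ac)

lemma group_reduced_simplicial_homology:
  assumes L: "simplicial_complex L"
  shows "group (reduced_simplicial_homology i L)"
proof -
  let ?C = "\<lambda>i. oriented_chain_group i L" and ?d = "chain_boundary_map L"
  have grp: "group (?C i)" for i
    using comm_group_oriented_chain_group comm_group_def by blast
  have hom: "?d \<in> hom (?C i) (?C (i - 1))" for i
    using chain_boundary_map_in_chains[OF L]
    by (auto simp: hom_def oriented_chain_group_def chain_boundary_map_def sum.distrib fun_eq_iff)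
  have gh: "group_hom (?C i) (?C (i - 1)) ?d" for i
    by (simp add: group_hom_def group_hom_axioms_def grp hom)
  have Z: "subgroup (simplicial_cycles i L) (?C i)"
    unfolding simplicial_cycles_def by (rule group_hom.subgroup_kernel[OF gh])
  have B: "subgroup (simplicial_boundaries i L) (?C i)"
    using group_hom.img_is_subgroup[OF gh[of "i + 1"]]
    by (simp add: simplicial_boundaries_def oriented_chain_group_def)
  have "simplicial_boundaries i L \<subseteq> simplicial_cycles i L"
  proof
    fix b assume "b \<in> simplicial_boundaries i L"
    then obtain c where c: "c \<in> oriented_chains (i + 1) L" "b = ?d c"
      unfolding simplicial_boundaries_def by blast
    have "b \<in> oriented_chains i L"
      using chain_boundary_map_in_chains[OF L c(1)] by (simp add: c(2))
    moreover have "?d b = (\<lambda>xs. 0)"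
      using chain_boundary_map_twice[OF c(1)] by (simp only: c(2))
    ultimately show "b \<in> simplicial_cycles i L"
      by (simp add: simplicial_cycles_def kernel_def oriented_chain_group_def)
  qed
  then have "subgroup (simplicial_boundaries i L) ((?C i)\<lparr>carrier := simplicial_cycles i L\<rparr>)"
    by (rule group.subgroup_incl[OF grp B Z])
  moreover have "comm_group ((?C i)\<lparr>carrier := simplicial_cycles i L\<rparr>)"
  proof (rule group.group_comm_groupI)
    show "group ((?C i)\<lparr>carrier := simplicial_cycles i L\<rparr>)"
      by (rule subgroup.subgroup_is_group[OF Z grp])
  qed (simp add: oriented_chain_group_def add.commute)
  ultimately show ?thesis
    unfolding reduced_simplicial_homology_def
    by (intro normal.factorgroup_is_group comm_group.subgroup_imp_normal)
qed

section \<open>Generalized homology spheres\<close>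

text \<open>
  For \<open>m \<ge> 0\<close> the sphere is the topological one. The library's reduced homology of the empty space
  vanishes in degree \<open>-1\<close>, so for \<open>m = -1\<close> the comparison is with the complex \<open>{{}}\<close> itself.
  Values \<open>m < -1\<close> are never used.
\<close>

definition has_homology_of_sphere :: "int \<Rightarrow> 'a set set \<Rightarrow> bool" where
  "has_homology_of_sphere m L \<longleftrightarrow>
     (\<forall>i. if m \<ge> 0
          then reduced_simplicial_homology i L \<cong> reduced_homology_group i (nsphere (nat m))
          else reduced_simplicial_homology i L \<cong> reduced_simplicial_homology i ({{}} :: 'a set set))"

definition generalized_homology_sphere :: "int \<Rightarrow> 'a set set \<Rightarrow> bool" where
  "generalized_homology_sphere m L \<longleftrightarrow>
     simplicial_complex L \<and> simplicial_dim L = m \<and>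
     (\<forall>\<sigma>\<in>L. simplicial_dim (link L \<sigma>) = m - int (card \<sigma>) \<and>
             has_homology_of_sphere (m - int (card \<sigma>)) (link L \<sigma>))"

section \<open>The f- and h-polynomials\<close>

definition f_poly :: "'a set set \<Rightarrow> real poly" where
  "f_poly L = (\<Sum>\<sigma>\<in>L. monom 1 (card \<sigma>))"

text \<open>
  \<open>(1 - t)\<^sup>n f(t / (1 - t))\<close> with the denominators cleared, where \<open>n = dim L + 1 \<ge> degree f\<close>.
  The lemmas below show that this is the polynomial determined by the defining identity.
\<close>

definition h_poly :: "'a set set \<Rightarrow> real poly" where
  "h_poly L =
     (let n = nat (simplicial_dim L + 1)
      in \<Sum>k\<le>n. smult (coeff (f_poly L) k) (monom 1 k * [:1, -1:] ^ (n - k)))"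

text \<open>
  The quotient of \<open>h\<close> by \<open>1 + t\<close>. For generalized homology spheres of even dimension the division
  is exact by the Dehn--Sommerville relations.
\<close>

definition h_tilde :: "'a set set \<Rightarrow> real poly" where
  "h_tilde L = h_poly L div [:1, 1:]"

lemma h_tilde_unique:
  assumes "h_poly L = [:1, 1:] * q"
  shows "h_tilde L = q"
  using assms by (simp add: h_tilde_def del: mult_pCons_left)

lemma degree_f_poly_le:
  assumes "simplicial_complex L"
  shows "degree (f_poly L) \<le> nat (simplicial_dim L + 1)"
proof -
  have "card \<sigma> \<le> nat (simplicial_dim L + 1)" if "\<sigma> \<in> L" for \<sigma>
  proof -
    have "int (card \<sigma>) - 1 \<le> simplicial_dim L"
      using assms that by (auto simp: simplicial_dim_def simplicial_complex_def)
    then show ?thesis by linarith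
  qed
  then show ?thesis
    unfolding f_poly_def using assms
    by (intro degree_sum_le) (auto simp: simplicial_complex_def degree_monom_eq)
qed

lemma poly_h_poly:
  assumes "simplicial_complex L" "t \<noteq> 1"
  shows "poly (h_poly L) t =
           (1 - t) ^ nat (simplicial_dim L + 1) * poly (f_poly L) (t / (1 - t))"
proof -
  define n where "n = nat (simplicial_dim L + 1)"
  have "(1 - t) ^ n * (t / (1 - t)) ^ k = t ^ k * (1 - t) ^ (n - k)" if "k \<le> n" for k
    using that assms(2) by (simp add: power_diff power_divide)
  moreover have "poly (f_poly L) x = (\<Sum>k\<le>n. coeff (f_poly L) k * x ^ k)" for x
    using degree_f_poly_le[OF assms(1)] unfolding n_def[symmetric]
    by (subst poly_altdef, intro sum.mono_neutral_left) (auto simp: coeff_eq_0)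
  ultimately show ?thesis
    unfolding h_poly_def Let_def n_def[symmetric]
    by (simp add: poly_sum poly_monom sum_distrib_left mult.left_commute)
qed

lemma h_poly_identity:
  assumes "simplicial_complex L" "t \<noteq> 0" "t \<noteq> -1"
  defines "n \<equiv> nat (simplicial_dim L + 1)"
  shows "(1 + t) ^ n * poly (h_poly L) (1 / (1 + t)) = t ^ n * poly (f_poly L) (1 / t)"
proof -
  have t: "1 + t \<noteq> 0" using assms(3) by (simp add: add_eq_0_iff)
  then have "1 - 1 / (1 + t) = t / (1 + t)" "1 / (1 + t) \<noteq> 1"
    using assms(2) by (simp_all add: field_simps)
  then show ?thesis
    using t assms(2) by (simp add: poly_h_poly[OF assms(1)] n_def power_divide)
qed

lemma h_poly_unique:
  assumes "simplicial_complex L"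
    and p: "\<And>t. t > 0 \<Longrightarrow> (1 + t) ^ nat (simplicial_dim L + 1) * poly p (1 / (1 + t)) =
             t ^ nat (simplicial_dim L + 1) * poly (f_poly L) (1 / t)"
  shows "p = h_poly L"
proof (rule ccontr)
  assume "p \<noteq> h_poly L"
  then have "finite {s. poly (p - h_poly L) s = 0}"
    by (intro poly_roots_finite) simp
  moreover have "{0<..<1} \<subseteq> {s. poly (p - h_poly L) s = 0}"
  proof
    fix s :: real assume s: "s \<in> {0<..<1}"
    define t where "t = 1 / s - 1"
    have t: "t > 0" "1 / (1 + t) = s"
      using s by (auto simp: t_def field_simps)
    have "(1 + t) ^ nat (simplicial_dim L + 1) * poly p s =
          (1 + t) ^ nat (simplicial_dim L + 1) * poly (h_poly L) s"
      using p[OF t(1)] h_poly_identity[OF assms(1), of t] t by auto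
    then show "s \<in> {s. poly (p - h_poly L) s = 0}"
      using t(1) by simp
  qed
  ultimately have "finite {0<..<1::real}" by (rule rev_finite_subset)
  then show False using infinite_Ioo[of "0::real" 1] by simp
qed

end

theory Submission
  imports Defs
begin

text \<open>
  For (B) \<open>\<Longrightarrow>\<close> (A), suspend \<open>L\<close>: flagness and the homology sphere condition are inherited, the
  dimension rises from \<open>2d - 1\<close> to \<open>2d\<close>, and \<open>h\<close> is multiplied by \<open>1 + t\<close>, so \<open>h_tilde\<close> of the
  suspension is \<open>h\<close> of \<open>L\<close>.

  For (A) \<open>\<Longrightarrow>\<close> (B), the Euler characteristics of the links give \<open>f(-1 - t) = (-1)^n f(t)\<close> with
  \<open>n = 2d + 1\<close>, hence \<open>f(-1/2) = 0\<close>. Since \<open>h(-1) = 2^n f(-1/2)\<close> and \<open>f'\<close> is the sum of the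
  \<open>f\<close>-polynomials of the vertex links, \<open>h_tilde(-1) = h'(-1)\<close> is half the sum of the values at
  \<open>-1\<close> of the \<open>h\<close>-polynomials of the vertex links, and these are flag spheres of dimension
  \<open>2d - 1\<close>.

  The Euler characteristic of a homology sphere is found by counting chains modulo 2: as the
  integral homology is free, reducing modulo 2 preserves exactness, and comparing cardinalities
  along the complex gives the alternating sum of the face numbers.
\<close>


section \<open>Alternating functions and cones\<close>

text \<open>The sign condition of \<open>oriented_chains\<close> on its own, so that it can be
  carried through constructions whose support is controlled separately.\<close>

definition alternating :: "('a list \<Rightarrow> int) \<Rightarrow> bool" where
  "alternating c \<longleftrightarrow> (\<forall>xs x y ys. c (xs @ y # x # ys) = - c (xs @ x # y # ys))"

lemma alternatingD: "alternating c \<Longrightarrow> c (xs @ y # x # ys) = - c (xs @ x # y # ys)"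
  unfolding alternating_def by blast

lemma alternating_swap: "alternating c \<Longrightarrow> c (y # x # ys) = - c (x # y # ys)"
  using alternatingD[of c "[]" y x ys] by simp

lemma alternating_Cons:
  assumes "alternating c"
  shows "alternating (\<lambda>xs. c (x # xs))"
  unfolding alternating_def
proof (intro allI)
  fix xs y z ys
  show "c (x # xs @ z # y # ys) = - c (x # xs @ y # z # ys)"
    using alternatingD[OF assms, of "x # xs" z y ys] by (simp only: append_Cons)
qed

text \<open>Carrying \<open>p\<close> to the front takes \<open>length as\<close> adjacent
  transpositions, each costing one sign.\<close>

lemma alternating_move:
  assumes "alternating c"
  shows "c (as @ p # bs) = (-1) ^ length as * c (p # as @ bs)"
  using assms
proof (induction as arbitrary: c)
  case (Cons a as)
  have "c (a # as @ p # bs) = (-1) ^ length as * c (a # p # as @ bs)"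
    by (rule Cons.IH[OF alternating_Cons[OF Cons.prems]])
  also have "c (a # p # as @ bs) = - c (p # a # as @ bs)"
    by (rule alternating_swap[OF Cons.prems])
  finally show ?case by simp
qed simp

text \<open>By induction, the head of \<open>xs\<close> is moved to the front of \<open>ys\<close>,
  and the sign disappears under the absolute value. So the parity of a coefficient depends only on
  the simplex, not on its ordering.\<close>

lemma alternating_abs_perm:
  assumes "alternating c" "mset xs = mset ys"
  shows "\<bar>c xs\<bar> = \<bar>c ys\<bar>"
  using assms
proof (induction xs arbitrary: c ys)
  case (Cons x xs)
  have "x \<in> set ys"
    using Cons.prems(2) by (metis list.set_intros(1) set_mset_mset)
  then obtain as bs where ys: "ys = as @ x # bs"
    by (meson split_list)
  then have "mset xs = mset (as @ bs)"
    using Cons.prems(2) by simp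
  then have "\<bar>c (x # xs)\<bar> = \<bar>c (x # as @ bs)\<bar>"
    by (rule Cons.IH[OF alternating_Cons[OF Cons.prems(1)]])
  then show ?case
    by (simp add: ys alternating_move[OF Cons.prems(1), of as] abs_mult)
qed simp

text \<open>Any occurrence of \<open>p\<close> can be moved to the front at the same cost for both
  functions, so lists avoiding \<open>p\<close> and lists starting with \<open>p\<close> decide
  equality.\<close>

lemma alternating_eqI:
  assumes alt: "alternating c" "alternating d"
    and without: "\<And>xs. p \<notin> set xs \<Longrightarrow> c xs = d xs"
    and first: "\<And>xs. c (p # xs) = d (p # xs)"
  shows "c = d"
proof
  fix xs
  show "c xs = d xs"
  proof (cases "p \<in> set xs")
    case True
    then obtain as bs where "xs = as @ p # bs"
      by (meson split_list)
    then show ?thesis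
      by (simp add: alternating_move[OF alt(1), of as] alternating_move[OF alt(2), of as] first)
  qed (rule without)
qed

lemma alternating_boundary:
  assumes "alternating c"
  shows "alternating (chain_boundary_map K c)"
  unfolding alternating_def chain_boundary_map_def sum_negf[symmetric]
  by (intro allI sum.cong refl alternatingD[OF alternating_Cons[OF assms]])

lemma alternating_add:
  assumes "alternating c" "alternating d"
  shows "alternating (\<lambda>xs. c xs + d xs)"
  unfolding alternating_def
proof (intro allI)
  fix xs x y ys
  show "c (xs @ y # x # ys) + d (xs @ y # x # ys) = - (c (xs @ x # y # ys) + d (xs @ x # y # ys))"
    using alternatingD[OF assms(1), of xs y x ys] alternatingD[OF assms(2), of xs y x ys] by linarith
qed

text \<open>The join of the vertex \<open>p\<close> with \<open>c\<close>. The sign is the one for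
  moving \<open>p\<close> to the front, which makes the formula meaningful at every
  ordering.\<close>

definition cone_chain :: "'a \<Rightarrow> ('a list \<Rightarrow> int) \<Rightarrow> 'a list \<Rightarrow> int" where
  "cone_chain p c xs =
     (if distinct xs \<and> p \<in> set xs
      then (-1) ^ length (takeWhile (\<lambda>x. x \<noteq> p) xs) * c (remove1 p xs) else 0)"

lemma cone_chain_Cons: "cone_chain p c (p # xs) = (if distinct xs \<and> p \<notin> set xs then c xs else 0)"
  by (simp add: cone_chain_def)

lemma cone_chain_notin: "p \<notin> set xs \<Longrightarrow> cone_chain p c xs = 0"
  by (simp add: cone_chain_def)

lemma cone_chain_zero: "cone_chain p (\<lambda>xs. 0) = (\<lambda>xs. 0)"
  by (simp add: cone_chain_def fun_eq_iff)

text \<open>A transposition away from \<open>p\<close> is a transposition in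
  \<open>remove1 p xs\<close>; one involving \<open>p\<close> changes the number of entries before
  \<open>p\<close> by one.\<close>

lemma alternating_cone:
  assumes "alternating c"
  shows "alternating (cone_chain p c)"
  unfolding alternating_def
proof (intro allI)
  fix xs x y ys
  show "cone_chain p c (xs @ y # x # ys) = - cone_chain p c (xs @ x # y # ys)"
  proof (cases "distinct (xs @ x # y # ys) \<and> p \<in> set (xs @ x # y # ys)")
    case True
    then consider "p \<in> set xs" | "p = x" "p \<notin> set xs" "y \<noteq> p" | "p = y" "p \<notin> set xs" "x \<noteq> p"
      | "p \<in> set ys" "p \<notin> set xs" "x \<noteq> p" "y \<noteq> p"
      by auto
    then show ?thesis
    proof cases
      case 1
      then show ?thesis
        using alternatingD[OF assms, of "remove1 p xs" y x ys]
        by (auto simp: cone_chain_def remove1_append)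
    next
      case 4
      then show ?thesis
        using alternatingD[OF assms, of xs y x "remove1 p ys"]
        by (auto simp: cone_chain_def remove1_append takeWhile_append)
    qed (auto simp: cone_chain_def remove1_append takeWhile_append remove1_idem)
  next
    case False
    then show ?thesis
      by (auto simp: cone_chain_def)
  qed
qed

text \<open>The contracting homotopy of a cone. \<open>chain_boundary_map\<close> sees
  \<open>K\<close> only through its vertices, so the identity also covers cones that leave
  \<open>K\<close>.\<close>

lemma cone_homotopy:
  assumes alt: "alternating c" and dist: "\<And>xs. c xs \<noteq> 0 \<Longrightarrow> distinct xs"
    and K: "finite (\<Union>K)" "p \<in> \<Union>K"
  shows "chain_boundary_map K (cone_chain p c) xs + cone_chain p (chain_boundary_map K c) xs = c xs"
proof -
  have "(\<lambda>xs. chain_boundary_map K (cone_chain p c) xs + cone_chain p (chain_boundary_map K c) xs) = c"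
    (is "?l = c")
  proof (rule alternating_eqI[where p = p])
    show "alternating ?l"
      by (intro alternating_add alternating_cone alternating_boundary alt)
  next
    fix xs assume p: "p \<notin> set xs"
    \<comment> \<open>A cone vanishes at lists without \<open>p\<close>, so only the vertex
      \<open>v = p\<close> contributes.\<close>
    have "chain_boundary_map K (cone_chain p c) xs = (\<Sum>v\<in>{p}. cone_chain p c (v # xs))"
      unfolding chain_boundary_map_def using K p
      by (intro sum.mono_neutral_right) (auto simp: cone_chain_def)
    then show "?l xs = c xs"
      using p dist[of xs] by (auto simp: cone_chain_notin cone_chain_Cons)
  next
    fix ys
    show "?l (p # ys) = c (p # ys)"
    proof (cases "distinct (p # ys)")
      case True
      \<comment> \<open>Exchanging \<open>v\<close> and \<open>p\<close> gives the sign; for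
        \<open>v = p\<close> the list has a repetition. The omitted term \<open>v = p\<close> of the
        boundary of \<open>c\<close> at \<open>ys\<close> is exactly the wanted
        \<open>c (p # ys)\<close>.\<close>
      have "cone_chain p c (v # p # ys) = - (if v = p then 0 else c (v # ys))" for v
        using True dist[of "v # ys"] alternating_swap[OF alternating_cone[OF alt, of p], of v p ys]
        by (auto simp: cone_chain_Cons)
      moreover have "(\<Sum>v\<in>\<Union>K. if v = p then 0 else c (v # ys))
          = chain_boundary_map K c ys - c (p # ys)"
        using sum.remove[OF K, of "\<lambda>v. c (v # ys)"]
          sum.remove[OF K, of "\<lambda>v. if v = p then 0 else c (v # ys)"]
        by (simp add: chain_boundary_map_def)
      ultimately show ?thesis
        using True by (simp add: chain_boundary_map_def[of K "cone_chain p c"] sum_negf cone_chain_Cons)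
    next
      case False
      then have "cone_chain p c (v # p # ys) = 0" for v
        by (auto simp: cone_chain_def)
      then show ?thesis
        using False dist[of "p # ys"] by (auto simp: chain_boundary_map_def cone_chain_Cons)
    qed
  qed (rule alt)
  then show ?thesis by (rule fun_cong)
qed

section \<open>Chains\<close>

lemma oriented_chains_iff:
  "c \<in> oriented_chains i L \<longleftrightarrow>
     alternating c \<and> (\<forall>xs. c xs \<noteq> 0 \<longrightarrow> distinct xs \<and> set xs \<in> L \<and> int (length xs) = i + 1)"
  by (auto simp: oriented_chains_def alternating_def)

lemma oriented_chains_mono: "L \<subseteq> K \<Longrightarrow> oriented_chains i L \<subseteq> oriented_chains i K"
  unfolding oriented_chains_iff subset_iff by blast

lemma oriented_chains_diff:
  assumes "c \<in> oriented_chains i L" "d \<in> oriented_chains i L"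
  shows "(\<lambda>xs. c xs - d xs) \<in> oriented_chains i L"
  using oriented_chains_closed(1)[OF assms(1) oriented_chains_closed(2)[OF assms(2,2)]] by simp

lemma simplicial_complex_finite_vertices: "simplicial_complex L \<Longrightarrow> finite (\<Union>L)"
  by (auto simp: simplicial_complex_def)

text \<open>A chain of \<open>L\<close> vanishes at lists containing a vertex outside
  \<open>L\<close>, so the additional summands are zero.\<close>

lemma boundary_mono:
  assumes "c \<in> oriented_chains i L" "L \<subseteq> K" "finite (\<Union>K)"
  shows "chain_boundary_map K c = chain_boundary_map L c"
proof
  fix xs
  have "c (v # xs) = 0" if "v \<notin> \<Union>L" for v
    using assms(1) that unfolding oriented_chains_iff by (metis UnionI list.set_intros(1))
  then show "chain_boundary_map K c xs = chain_boundary_map L c xs"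
    unfolding chain_boundary_map_def using assms
    by (intro sum.mono_neutral_right) auto
qed

lemma boundary_add:
  "chain_boundary_map L (\<lambda>xs. c xs + d xs) = (\<lambda>xs. chain_boundary_map L c xs + chain_boundary_map L d xs)"
  by (simp add: fun_eq_iff chain_boundary_map_def sum.distrib)

lemma boundary_diff:
  "chain_boundary_map L (\<lambda>xs. c xs - d xs) = (\<lambda>xs. chain_boundary_map L c xs - chain_boundary_map L d xs)"
  by (simp add: fun_eq_iff chain_boundary_map_def sum_subtractf)

lemma boundary_minus:
  "chain_boundary_map L (\<lambda>xs. - c xs) = (\<lambda>xs. - chain_boundary_map L c xs)"
  by (simp add: fun_eq_iff chain_boundary_map_def sum_negf)

lemma boundary_scale:
  "chain_boundary_map L (\<lambda>xs. k * c xs) = (\<lambda>xs. k * chain_boundary_map L c xs)"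
  by (simp add: fun_eq_iff chain_boundary_map_def sum_distrib_left)

lemma cycles_iff:
  "c \<in> simplicial_cycles i L \<longleftrightarrow> c \<in> oriented_chains i L \<and> chain_boundary_map L c = (\<lambda>xs. 0)"
  by (auto simp: simplicial_cycles_def kernel_def oriented_chain_group_def)

lemma oriented_chains_uminus: "c \<in> oriented_chains i L \<Longrightarrow> (\<lambda>xs. - c xs) \<in> oriented_chains i L"
  by (rule oriented_chains_closed(2))

lemma zero_chain: "(\<lambda>xs. 0) \<in> oriented_chains i L"
  by (simp add: oriented_chains_def)

lemma boundary_zero: "chain_boundary_map L (\<lambda>xs. 0) = (\<lambda>xs. 0)"
  by (simp add: fun_eq_iff chain_boundary_map_def)

lemma zero_cycle: "(\<lambda>xs. 0) \<in> simplicial_cycles i L"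
  by (simp add: cycles_iff zero_chain boundary_zero)

lemma zero_boundary: "(\<lambda>xs. 0) \<in> simplicial_boundaries i L"
  unfolding simplicial_boundaries_def
  by (rule image_eqI[where x = "\<lambda>xs. 0"]) (simp_all add: boundary_zero zero_chain)

lemma cycles_uminus:
  assumes "c \<in> simplicial_cycles i L"
  shows "(\<lambda>xs. - c xs) \<in> simplicial_cycles i L"
  using assms by (simp add: cycles_iff oriented_chains_uminus boundary_minus)

lemma cycles_add:
  assumes "c \<in> simplicial_cycles i L" "d \<in> simplicial_cycles i L"
  shows "(\<lambda>xs. c xs + d xs) \<in> simplicial_cycles i L"
  using assms by (simp add: cycles_iff oriented_chains_closed boundary_add)

lemma cycles_diff:
  assumes "c \<in> simplicial_cycles i L" "d \<in> simplicial_cycles i L"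
  shows "(\<lambda>xs. c xs - d xs) \<in> simplicial_cycles i L"
  using assms by (simp add: cycles_iff oriented_chains_diff boundary_diff)

lemma boundaries_subset_cycles:
  "simplicial_complex L \<Longrightarrow> simplicial_boundaries i L \<subseteq> simplicial_cycles i L"
  using chain_boundary_map_in_chains[of L _ "i + 1"] chain_boundary_map_twice[of _ "i + 1" L]
  by (auto simp: simplicial_boundaries_def cycles_iff)

lemma boundaries_uminus:
  assumes "c \<in> simplicial_boundaries i L"
  shows "(\<lambda>xs. - c xs) \<in> simplicial_boundaries i L"
proof -
  obtain b where "b \<in> oriented_chains (i + 1) L" "c = chain_boundary_map L b"
    using assms by (auto simp: simplicial_boundaries_def)
  then show ?thesis
    unfolding simplicial_boundaries_def
    by (intro image_eqI[of _ _ "\<lambda>xs. - b xs"]) (simp_all add: boundary_minus oriented_chains_uminus)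
qed

lemma boundaries_add:
  assumes "c \<in> simplicial_boundaries i L" "d \<in> simplicial_boundaries i L"
  shows "(\<lambda>xs. c xs + d xs) \<in> simplicial_boundaries i L"
proof -
  obtain a b where "a \<in> oriented_chains (i + 1) L" "c = chain_boundary_map L a"
    "b \<in> oriented_chains (i + 1) L" "d = chain_boundary_map L b"
    using assms by (auto simp: simplicial_boundaries_def)
  then show ?thesis
    unfolding simplicial_boundaries_def
    by (intro image_eqI[of _ _ "\<lambda>xs. a xs + b xs"]) (simp_all add: boundary_add oriented_chains_closed)
qed

text \<open>Only simplices in the support of \<open>c\<close> have to be joinable to
  \<open>p\<close>. This permits coning a chain of a suspension that avoids the opposite
  apex.\<close>

lemma cone_in_chains:
  assumes c: "c \<in> oriented_chains i K" 
    and K': "\<And>xs. c xs \<noteq> 0 \<Longrightarrow> p \<notin> set xs \<Longrightarrow> insert p (set xs) \<in> K'"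
  shows "cone_chain p c \<in> oriented_chains (i + 1) K'"
proof -
  have "distinct xs \<and> set xs \<in> K' \<and> int (length xs) = i + 1 + 1" if "cone_chain p c xs \<noteq> 0" for xs
  proof -
    have xs: "distinct xs" "p \<in> set xs" "c (remove1 p xs) \<noteq> 0"
      using that by (auto simp: cone_chain_def split: if_splits)
    then have "insert p (set (remove1 p xs)) \<in> K'"
      by (intro K') auto
    moreover have "insert p (set (remove1 p xs)) = set xs"
      using xs by auto
    moreover have "int (length (remove1 p xs)) = i + 1"
      using c xs by (auto simp: oriented_chains_iff)
    moreover have "length xs > 0"
      using xs by auto
    ultimately show ?thesis
      using xs by (simp add: length_remove1)
  qed
  then show ?thesis
    using c by (simp add: oriented_chains_iff alternating_cone)
qed

lemma chain_alternating: "c \<in> oriented_chains i L \<Longrightarrow> alternating c"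
  by (simp add: oriented_chains_iff)

lemma chain_distinct: "c \<in> oriented_chains i L \<Longrightarrow> c xs \<noteq> 0 \<Longrightarrow> distinct xs"
  by (simp add: oriented_chains_iff)

lemma chain_support: "c \<in> oriented_chains i L \<Longrightarrow> c xs \<noteq> 0 \<Longrightarrow> set xs \<in> L"
  by (simp add: oriented_chains_iff)

section \<open>Homology of spheres in terms of chains\<close>

lemma group_cycles:
  assumes "simplicial_complex L"
  shows "group ((oriented_chain_group i L)\<lparr>carrier := simplicial_cycles i L\<rparr>)"
    (is "group ?Z")
proof (rule groupI)
  fix c assume "c \<in> carrier ?Z"
  then show "\<exists>d\<in>carrier ?Z. d \<otimes>\<^bsub>?Z\<^esub> c = \<one>\<^bsub>?Z\<^esub>"
    by (intro bexI[of _ "\<lambda>xs. - c xs"]) (simp_all add: oriented_chain_group_def cycles_uminus)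
qed (simp_all add: oriented_chain_group_def cycles_add zero_cycle add_ac)

lemma normal_boundaries:
  assumes L: "simplicial_complex L"
  shows "simplicial_boundaries i L \<lhd> (oriented_chain_group i L)\<lparr>carrier := simplicial_cycles i L\<rparr>"
    (is "?B \<lhd> ?Z")
proof (rule comm_group.subgroup_imp_normal)
  have inv: "inv\<^bsub>?Z\<^esub> c = (\<lambda>xs. - c xs)" if "c \<in> simplicial_cycles i L" for c
    using that
    by (intro group.inv_equality[OF group_cycles[OF L]])
      (simp_all add: oriented_chain_group_def cycles_uminus)
  show "subgroup ?B ?Z"
  proof (rule subgroup.intro)
    show "?B \<subseteq> carrier ?Z"
      using boundaries_subset_cycles[OF L] by simp
    show "inv\<^bsub>?Z\<^esub> c \<in> ?B" if "c \<in> ?B" for c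
      using that boundaries_subset_cycles[OF L, of i] inv[of c] boundaries_uminus[of c i L] by auto
  qed (simp_all add: oriented_chain_group_def zero_boundary boundaries_add)
  show "comm_group ?Z"
    by (rule group.group_comm_groupI[OF group_cycles[OF L]])
      (simp add: oriented_chain_group_def add.commute)
qed

section \<open>Quotient groups without cosets\<close>

lemma (in normal) coset_eq_subgroup_iff:
  assumes "x \<in> carrier G"
  shows "H #> x = H \<longleftrightarrow> x \<in> H"
  using assms rcos_const[of x] rcos_self[OF assms is_subgroup] by auto

lemma (in normal) trivial_FactGroup_iff: "trivial_group (G Mod H) \<longleftrightarrow> carrier G = H"
proof -
  have "trivial_group (G Mod H) \<longleftrightarrow> (\<forall>x\<in>carrier G. H #> x = H)"
    unfolding group.trivial_group_subset[OF factorgroup_is_group]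
    by (auto simp: FactGroup_def RCOSETS_def)
  also have "\<dots> \<longleftrightarrow> carrier G = H"
    using coset_eq_subgroup_iff subset by blast
  finally show ?thesis .
qed

text \<open>The first isomorphism theorem together with its converse, where the given isomorphism is
  composed with the quotient map. It trades isomorphisms out of a quotient for surjections with
  prescribed kernel.\<close>

lemma (in normal) FactGroup_iso_iff:
  assumes K: "group K"
  shows "G Mod H \<cong> K \<longleftrightarrow>
    (\<exists>\<psi>\<in>hom G K. \<psi> ` carrier G = carrier K \<and> kernel G K \<psi> = H)"
proof
  assume "G Mod H \<cong> K"
  then obtain h where h: "h \<in> iso (G Mod H) K"
    by (auto simp: is_iso_def)
  let ?\<psi> = "\<lambda>x. h (H #> x)"
  interpret Q: group_hom "G Mod H" K h
    using h K by (simp add: group_hom_def group_hom_axioms_def factorgroup_is_group iso_imp_homomorphism)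
  have carr: "carrier (G Mod H) = (\<lambda>x. H #> x) ` carrier G"
    by (auto simp: FactGroup_def RCOSETS_def)
  have hom: "?\<psi> \<in> hom G K"
  proof (rule homI)
    fix x y assume xy: "x \<in> carrier G" "y \<in> carrier G"
    then show "h (H #> x) \<in> carrier K"
      by (simp add: carr)
    show "h (H #> x \<otimes> y) = h (H #> x) \<otimes>\<^bsub>K\<^esub> h (H #> y)"
      using hom_mult[OF r_coset_hom_Mod xy] hom_mult[OF Q.homh, of "H #> x" "H #> y"] xy
      by (simp add: carr)
  qed
  have bij: "bij_betw h (carrier (G Mod H)) (carrier K)"
    using h by (simp add: iso_def)
  have "h (H #> x) = \<one>\<^bsub>K\<^esub> \<longleftrightarrow> x \<in> H" if x: "x \<in> carrier G" for x
  proof -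
    have "h H = \<one>\<^bsub>K\<^esub>" "H \<in> carrier (G Mod H)"
      using Q.hom_one Q.G.one_closed by (simp_all add: FactGroup_def)
    then have "h (H #> x) = \<one>\<^bsub>K\<^esub> \<longleftrightarrow> H #> x = H"
      using bij inj_on_eq_iff[of h "carrier (G Mod H)" "H #> x" H] x by (simp add: bij_betw_def carr)
    then show ?thesis
      using coset_eq_subgroup_iff[OF x] by simp
  qed
  then have "kernel G K ?\<psi> = H"
    using subset by (auto simp: kernel_def)
  moreover have "?\<psi> ` carrier G = carrier K"
    using bij carr by (simp add: bij_betw_def image_image)
  ultimately show "\<exists>\<psi>\<in>hom G K. \<psi> ` carrier G = carrier K \<and> kernel G K \<psi> = H"
    by (intro bexI[OF _ hom] conjI)
next
  assume "\<exists>\<psi>\<in>hom G K. \<psi> ` carrier G = carrier K \<and> kernel G K \<psi> = H"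
  then obtain \<psi> where \<psi>: "\<psi> \<in> hom G K" "\<psi> ` carrier G = carrier K" "kernel G K \<psi> = H"
    by blast
  interpret P: group_hom G K \<psi>
    using \<psi>(1) K by (simp add: group_hom_def group_hom_axioms_def is_group)
  show "G Mod H \<cong> K"
    using P.FactGroup_iso[OF \<psi>(2)] by (simp only: \<psi>(3))
qed

lemma trivial_homology_iff:
  assumes L: "simplicial_complex L"
  shows "trivial_group (reduced_simplicial_homology i L) \<longleftrightarrow> simplicial_cycles i L = simplicial_boundaries i L"
  using normal.trivial_FactGroup_iff[OF normal_boundaries[OF L]]
  by (simp add: reduced_simplicial_homology_def)

text \<open>The first isomorphism theorem spelled out on cycles: such a \<open>\<psi>\<close> exists
  exactly when the homology in degree \<open>i\<close> is isomorphic to the integers. Values of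
  \<open>\<psi>\<close> off the cycles are irrelevant.\<close>

definition infinite_cyclic_homology :: "int \<Rightarrow> 'a set set \<Rightarrow> (('a list \<Rightarrow> int) \<Rightarrow> int) \<Rightarrow> bool" where
  "infinite_cyclic_homology i L \<psi> \<longleftrightarrow>
     (\<forall>c\<in>simplicial_cycles i L. \<forall>d\<in>simplicial_cycles i L. \<psi> (\<lambda>xs. c xs + d xs) = \<psi> c + \<psi> d) \<and>
     \<psi> ` simplicial_cycles i L = UNIV \<and>
     (\<forall>c\<in>simplicial_cycles i L. \<psi> c = 0 \<longleftrightarrow> c \<in> simplicial_boundaries i L)"

lemma homology_iso_integer_group_iff:
  assumes L: "simplicial_complex L"
  shows "reduced_simplicial_homology i L \<cong> integer_group \<longleftrightarrow> (\<exists>\<psi>. infinite_cyclic_homology i L \<psi>)"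
proof -
  let ?Z = "(oriented_chain_group i L)\<lparr>carrier := simplicial_cycles i L\<rparr>"
  have "kernel ?Z integer_group \<psi> = simplicial_boundaries i L \<longleftrightarrow>
    (\<forall>c\<in>simplicial_cycles i L. \<psi> c = 0 \<longleftrightarrow> c \<in> simplicial_boundaries i L)" for \<psi>
    using boundaries_subset_cycles[OF L, of i] by (auto simp: kernel_def)
  moreover have "\<psi> \<in> hom ?Z integer_group \<longleftrightarrow>
    (\<forall>c\<in>simplicial_cycles i L. \<forall>d\<in>simplicial_cycles i L. \<psi> (\<lambda>xs. c xs + d xs) = \<psi> c + \<psi> d)" for \<psi>
    by (simp add: hom_def oriented_chain_group_def)
  ultimately show ?thesis
    unfolding reduced_simplicial_homology_def
      normal.FactGroup_iso_iff[OF normal_boundaries[OF L] group_integer_group] infinite_cyclic_homology_def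
    by (simp add: Bex_def)
qed

lemma trivial_groups_isomorphic:
  assumes "trivial_group G" "trivial_group H"
  shows "G \<cong> H"
proof (rule is_isoI)
  show "(\<lambda>x. \<one>\<^bsub>H\<^esub>) \<in> iso G H"
    using assms by (auto simp: iso_def hom_def trivial_group_def bij_betw_def group.is_monoid)
qed

text \<open>\<open>S\<close> stands for the degree \<open>i\<close> homology of the
  \<open>m\<close>-sphere; the comparison with it becomes an intrinsic condition on
  \<open>G\<close>.\<close>

lemma isomorphic_integer_or_trivial_group_iff:
  assumes "group G" "group S" "if i = m then S \<cong> integer_group else trivial_group S"
  shows "G \<cong> S \<longleftrightarrow> (if i = m then G \<cong> integer_group else trivial_group G)"
proof (cases "i = m")
  case True
  then show ?thesis
    using assms iso_trans[of G S integer_group] iso_trans[of G integer_group S] group.iso_sym[OF assms(2)]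
    by auto
next
  case False
  then show ?thesis
    using assms trivial_groups_isomorphic[of G S] isomorphic_group_triviality[of G S] by auto
qed

text \<open>There are no vertices to sum over, so all boundary maps vanish, and the only nonzero
  chains are the integer multiples of the empty ordering in degree \<open>-1\<close>.\<close>

lemma empty_complex_homology:
  "if i = -1 then reduced_simplicial_homology i ({{}} :: 'a set set) \<cong> integer_group
   else trivial_group (reduced_simplicial_homology i ({{}} :: 'a set set))"
proof -
  have L: "simplicial_complex ({{}} :: 'a set set)"
    by (auto simp: simplicial_complex_def)
  have zero: "chain_boundary_map {{}} c = (\<lambda>xs. 0)" for c :: "'a list \<Rightarrow> int"
    by (simp add: fun_eq_iff chain_boundary_map_def)
  have chains: "oriented_chains j {{}} = {c :: 'a list \<Rightarrow> int. \<forall>xs. c xs \<noteq> 0 \<longrightarrow> xs = [] \<and> j = -1}" for j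
  proof (rule Set.set_eqI)
    fix c :: "'a list \<Rightarrow> int"
    \<comment> \<open>The lists in the sign condition have at least two entries, so both sides are
      zero.\<close>
    have "alternating c" if c: "\<forall>xs. c xs \<noteq> 0 \<longrightarrow> xs = []"
      unfolding alternating_def
    proof (intro allI)
      fix xs x y ys
      have "c (xs @ y # x # ys) = 0" "c (xs @ x # y # ys) = 0"
        using c by blast+
      then show "c (xs @ y # x # ys) = - c (xs @ x # y # ys)" by simp
    qed
    then show "c \<in> oriented_chains j {{}} \<longleftrightarrow> c \<in> {c. \<forall>xs. c xs \<noteq> 0 \<longrightarrow> xs = [] \<and> j = -1}"
      unfolding oriented_chains_iff by auto
  qed
  have cycles: "simplicial_cycles j {{}} = {c :: 'a list \<Rightarrow> int. \<forall>xs. c xs \<noteq> 0 \<longrightarrow> xs = [] \<and> j = -1}" for j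
    by (auto simp: cycles_iff zero chains)
  have boundaries: "simplicial_boundaries j {{}} = {\<lambda>xs :: 'a list. 0}" for j
    by (auto simp: simplicial_boundaries_def zero chains)
  show ?thesis
  proof (cases "i = -1")
    case True
    have "\<exists>c. (\<forall>xs. c xs \<noteq> 0 \<longrightarrow> xs = []) \<and> k = c []" for k :: int
      by (rule exI[of _ "\<lambda>xs. if xs = [] then k else 0"]) simp
    moreover have "c [] = 0 \<longleftrightarrow> c = (\<lambda>xs. 0)" if "\<forall>xs. c xs \<noteq> 0 \<longrightarrow> xs = []" for c :: "'a list \<Rightarrow> int"
      using that by (auto simp: fun_eq_iff)
    ultimately have "infinite_cyclic_homology (-1) ({{}} :: 'a set set) (\<lambda>c. c [])"
      unfolding infinite_cyclic_homology_def cycles boundaries by (auto simp: image_iff)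
    then show ?thesis
      using True homology_iso_integer_group_iff[OF L] by auto
  next
    case False
    then show ?thesis
      by (auto simp: trivial_homology_iff[OF L] cycles boundaries fun_eq_iff)
  qed
qed

text \<open>Treats the topological spheres and the complex \<open>{{}}\<close> uniformly: each has
  integer homology in degree \<open>m\<close> and trivial homology elsewhere. From here on only
  cycles and boundaries occur.\<close>

lemma has_homology_of_sphere_iff:
  assumes L: "simplicial_complex L" and m: "m \<ge> -1"
  shows "has_homology_of_sphere m L \<longleftrightarrow>
    (\<forall>i. i \<noteq> m \<longrightarrow> simplicial_cycles i L = simplicial_boundaries i L) \<and>
    (\<exists>\<psi>. infinite_cyclic_homology m L \<psi>)"
proof -
  have L0: "simplicial_complex ({{}} :: 'a set set)"
    by (auto simp: simplicial_complex_def)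
  have "has_homology_of_sphere m L \<longleftrightarrow>
    (\<forall>i. if i = m then reduced_simplicial_homology i L \<cong> integer_group
         else trivial_group (reduced_simplicial_homology i L))"
  proof (cases "m \<ge> 0")
    case True
    then have "if i = m then reduced_homology_group i (nsphere (nat m)) \<cong> integer_group
      else trivial_group (reduced_homology_group i (nsphere (nat m)))" for i
      using reduced_homology_group_nsphere[where n = "nat m"] by auto
    then have "reduced_simplicial_homology i L \<cong> reduced_homology_group i (nsphere (nat m)) \<longleftrightarrow>
      (if i = m then reduced_simplicial_homology i L \<cong> integer_group
       else trivial_group (reduced_simplicial_homology i L))" for i
      by (intro isomorphic_integer_or_trivial_group_iff group_reduced_simplicial_homology[OF L]
          group_reduced_homology_group)
    then show ?thesis
      using True by (simp add: has_homology_of_sphere_def)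
  next
    case False
    then have "m = -1" using m by simp
    then have "reduced_simplicial_homology i L \<cong> reduced_simplicial_homology i ({{}} :: 'a set set) \<longleftrightarrow>
      (if i = m then reduced_simplicial_homology i L \<cong> integer_group
       else trivial_group (reduced_simplicial_homology i L))" for i
      unfolding \<open>m = -1\<close>
      by (intro isomorphic_integer_or_trivial_group_iff group_reduced_simplicial_homology L L0
          empty_complex_homology)
    then show ?thesis
      using False by (simp add: has_homology_of_sphere_def)
  qed
  then show ?thesis
    by (auto simp: trivial_homology_iff[OF L] homology_iso_integer_group_iff[OF L])
qed

section \<open>Suspensions\<close>

definition suspension :: "'a \<Rightarrow> 'a \<Rightarrow> 'a set set \<Rightarrow> 'a set set" where
  "suspension p q L = L \<union> insert p ` L \<union> insert q ` L"

lemma subset_suspension: "L \<subseteq> suspension p q L"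
  by (auto simp: suspension_def)

lemma suspension_commute: "suspension p q L = suspension q p L"
  by (auto simp: suspension_def)

text \<open>The chain-level suspension isomorphism sends \<open>c\<close> to its part at \<open>p\<close>, \<open>xs \<mapsto> c (p # xs)\<close>.\<close>

locale suspended_complex =
  fixes L :: "'a set set" and p q :: 'a
  assumes complex: "simplicial_complex L"
    and p: "p \<notin> \<Union>L" and q: "q \<notin> \<Union>L" and pq: "p \<noteq> q"
begin

abbreviation "K \<equiv> suspension p q L"

lemma simplicial_complex_suspension: "simplicial_complex K"
proof -
  have "\<tau> \<in> L \<or> \<tau> \<in> insert v ` L" if "\<tau> \<subseteq> insert v \<sigma>" "\<sigma> \<in> L" for v \<tau> \<sigma>
  proof -
    have sub: "\<rho> \<in> L" if "\<rho> \<subseteq> \<sigma>" for \<rho>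
      using complex \<open>\<sigma> \<in> L\<close> that unfolding simplicial_complex_def by blast
    show ?thesis
    proof (cases "v \<in> \<tau>")
      case True
      then have "\<tau> = insert v (\<tau> - {v})" by auto
      moreover have "\<tau> - {v} \<in> L" using that(1) by (intro sub) auto
      ultimately show ?thesis by blast
    next
      case False
      then show ?thesis using that(1) by (intro disjI1 sub) auto
    qed
  qed
  then have "\<tau> \<in> K" if "\<tau> \<subseteq> \<sigma>" "\<sigma> \<in> K" for \<sigma> \<tau>
    using that unfolding suspension_def by blast
  moreover have "finite K" "{} \<in> K" "\<forall>\<sigma>\<in>K. finite \<sigma>"
    using complex by (auto simp: suspension_def simplicial_complex_def)
  ultimately show ?thesis
    unfolding simplicial_complex_def by blast
qed

lemma vertices_suspension: "\<Union>K = insert p (insert q (\<Union>L))"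
  using complex by (auto simp: suspension_def simplicial_complex_def)

lemma finite_vertices: "finite (\<Union>K)"
  by (rule simplicial_complex_finite_vertices[OF simplicial_complex_suspension])

lemma in_suspension_cases:
  assumes "\<sigma> \<in> K"
  obtains "\<sigma> \<in> L" "p \<notin> \<sigma>" "q \<notin> \<sigma>"
    | \<tau> where "\<sigma> = insert p \<tau>" "\<tau> \<in> L" "p \<notin> \<tau>" "q \<notin> \<tau>"
    | \<tau> where "\<sigma> = insert q \<tau>" "\<tau> \<in> L" "p \<notin> \<tau>" "q \<notin> \<tau>"
  using assms p q unfolding suspension_def by blast

text \<open>The link of the apex \<open>p\<close> is \<open>L\<close>; in particular no simplex
  contains both apexes.\<close>

lemma insert_in_suspension_iff:
  assumes "p \<notin> \<sigma>"
  shows "insert p \<sigma> \<in> K \<longleftrightarrow> \<sigma> \<in> L"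
proof
  assume "insert p \<sigma> \<in> K"
  then show "\<sigma> \<in> L"
    by (cases rule: in_suspension_cases) (use assms pq in \<open>auto simp: insert_eq_iff\<close>)
qed (auto simp: suspension_def)

lemma desuspend_chain:
  assumes c: "c \<in> oriented_chains (i + 1) K"
  shows "(\<lambda>xs. c (p # xs)) \<in> oriented_chains i L"
proof -
  have "distinct xs \<and> set xs \<in> L \<and> int (length xs) = i + 1" if "c (p # xs) \<noteq> 0" for xs
  proof -
    have "distinct (p # xs) \<and> set (p # xs) \<in> K \<and> int (length (p # xs)) = i + 1 + 1"
      using c that unfolding oriented_chains_iff by blast
    then show ?thesis
      using insert_in_suspension_iff[of "set xs"] by simp
  qed
  then show ?thesis
    using c by (simp add: oriented_chains_iff alternating_Cons)
qed

text \<open>The sign comes from exchanging the summation vertex with \<open>p\<close>. It is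
  harmless, as cycles and boundaries are closed under negation.\<close>

lemma desuspend_boundary:
  assumes c: "c \<in> oriented_chains (i + 1) K"
  shows "chain_boundary_map K c (p # xs) = - chain_boundary_map L (\<lambda>ys. c (p # ys)) xs"
proof -
  have "chain_boundary_map K c (p # xs) = - chain_boundary_map K (\<lambda>ys. c (p # ys)) xs"
    unfolding chain_boundary_map_def sum_negf[symmetric]
    by (intro sum.cong refl alternating_swap[OF chain_alternating[OF c]])
  then show ?thesis
    using boundary_mono[OF desuspend_chain[OF c] subset_suspension finite_vertices] by simp
qed

lemma desuspend_cycle:
  assumes c: "c \<in> simplicial_cycles (i + 1) K"
  shows "(\<lambda>xs. c (p # xs)) \<in> simplicial_cycles i L"
proof -
  have "chain_boundary_map L (\<lambda>ys. c (p # ys)) xs = 0" for xs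
    using desuspend_boundary[of c i xs] c by (simp add: cycles_iff)
  then show ?thesis
    using c by (simp add: cycles_iff desuspend_chain fun_eq_iff)
qed

lemma desuspend_boundaries:
  assumes "c \<in> simplicial_boundaries (i + 1) K"
  shows "(\<lambda>xs. c (p # xs)) \<in> simplicial_boundaries i L"
proof -
  obtain b where b: "b \<in> oriented_chains (i + 1 + 1) K" "c = chain_boundary_map K b"
    using assms by (auto simp: simplicial_boundaries_def)
  have "(\<lambda>xs. c (p # xs)) = (\<lambda>xs. - chain_boundary_map L (\<lambda>ys. b (p # ys)) xs)"
    by (simp add: b(2) desuspend_boundary[OF b(1)])
  moreover have "chain_boundary_map L (\<lambda>ys. b (p # ys)) \<in> simplicial_boundaries i L"
    using desuspend_chain[OF b(1)] by (auto simp: simplicial_boundaries_def)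
  ultimately show ?thesis
    using boundaries_uminus by metis
qed

lemma cone_chain_in_suspension:
  assumes c: "c \<in> oriented_chains i L" and v: "v = p \<or> v = q"
  shows "cone_chain v c \<in> oriented_chains (i + 1) K"
  using c v by (intro cone_in_chains[where K = L]) (auto simp: suspension_def dest: chain_support)

lemma cone_chain_p:
  assumes c: "c \<in> oriented_chains i L"
  shows "cone_chain p c (p # xs) = c xs"
  using p chain_distinct[OF c, of xs] chain_support[OF c, of xs] by (auto simp: cone_chain_Cons)

lemma cone_chain_q:
  assumes c: "c \<in> oriented_chains i L"
  shows "cone_chain q c (p # xs) = 0"
proof -
  have "c (remove1 q (p # xs)) = 0"
    using p pq chain_support[OF c, of "remove1 q (p # xs)"] by auto
  then show ?thesis by (simp add: cone_chain_def)
qed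

text \<open>For a cycle the second term of \<open>cone_homotopy\<close> is zero. This alone does not
  make \<open>z\<close> a boundary: the cone is a chain of \<open>K\<close> only if \<open>z\<close>
  avoids the opposite apex.\<close>

lemma boundary_cone_chain_cycle:
  assumes z: "z \<in> simplicial_cycles i K" and v: "v = p \<or> v = q"
  shows "chain_boundary_map K (cone_chain v z) = z"
proof
  fix xs
  have "z \<in> oriented_chains i K" "chain_boundary_map K z = (\<lambda>xs. 0)"
    using z by (simp_all add: cycles_iff)
  then show "chain_boundary_map K (cone_chain v z) xs = z xs"
    using cone_homotopy[of z K v xs] v finite_vertices
    by (auto simp: cone_chain_zero oriented_chains_iff vertices_suspension)
qed

lemma cycles_subset_suspension: "simplicial_cycles i L \<subseteq> simplicial_cycles i K"
proof
  fix c assume "c \<in> simplicial_cycles i L"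
  then show "c \<in> simplicial_cycles i K"
    using boundary_mono[of c i L K] subset_suspension[of L p q] finite_vertices
      oriented_chains_mono[of L K i]
    by (auto simp: cycles_iff)
qed

lemma desuspend_cycle_surj:
  assumes z: "z \<in> simplicial_cycles i L"
  obtains c where "c \<in> simplicial_cycles (i + 1) K" "(\<lambda>xs. c (p # xs)) = z"
proof
  have zc: "z \<in> oriented_chains i L"
    using z by (simp add: cycles_iff)
  have zK: "z \<in> simplicial_cycles i K"
    using z cycles_subset_suspension by blast
  \<comment> \<open>The suspension of \<open>z\<close>: two cones with the same boundary
    \<open>z\<close>, glued along it. Only the cone over \<open>p\<close> has a part at
    \<open>p\<close>.\<close>
  let ?c = "\<lambda>xs. cone_chain p z xs - cone_chain q z xs"
  show "?c \<in> simplicial_cycles (i + 1) K"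
    using zc by (simp add: cycles_iff oriented_chains_diff cone_chain_in_suspension boundary_diff
        boundary_cone_chain_cycle[OF zK])
  show "(\<lambda>xs. ?c (p # xs)) = z"
    by (simp add: cone_chain_p[OF zc] cone_chain_q[OF zc])
qed

text \<open>Together with \<open>desuspend_cycle\<close> and \<open>desuspend_cycle_surj\<close>,
  this makes taking the part at \<open>p\<close> an isomorphism from homology of \<open>K\<close> in
  degree \<open>i + 1\<close> to homology of \<open>L\<close> in degree \<open>i\<close>.\<close>

lemma desuspend_boundaries_iff:
  assumes c: "c \<in> simplicial_cycles (i + 1) K"
  shows "(\<lambda>xs. c (p # xs)) \<in> simplicial_boundaries i L \<longleftrightarrow> c \<in> simplicial_boundaries (i + 1) K"
proof
  assume "(\<lambda>xs. c (p # xs)) \<in> simplicial_boundaries i L"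
  then obtain b where b: "b \<in> oriented_chains (i + 1) L" "(\<lambda>xs. c (p # xs)) = chain_boundary_map L b"
    by (auto simp: simplicial_boundaries_def)
  have pb: "cone_chain p b \<in> oriented_chains (i + 1 + 1) K"
    using cone_chain_in_suspension[OF b(1)] by blast
  \<comment> \<open>Modulo a boundary, \<open>c\<close> avoids \<open>p\<close>, so it lies in the cone over \<open>q\<close>, which is acyclic.\<close>
  let ?c' = "\<lambda>xs. c xs + chain_boundary_map K (cone_chain p b) xs"
  have c': "?c' \<in> simplicial_cycles (i + 1) K"
    using boundaries_subset_cycles[OF simplicial_complex_suspension, of "i + 1"] pb
    by (intro cycles_add c) (auto simp: simplicial_boundaries_def)
  \<comment> \<open>By the sign in \<open>desuspend_boundary\<close>, the added boundary has part at
    \<open>p\<close> equal to minus the boundary of \<open>b\<close>, which cancels that of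
    \<open>c\<close>.\<close>
  have "?c' (p # xs) = 0" for xs
    using fun_cong[OF b(2), of xs]
    by (simp add: desuspend_boundary[OF pb] cone_chain_p[OF b(1)])
  then have no_p: "?c' xs = 0" if "p \<in> set xs" for xs
  proof -
    from split_list[OF that] obtain as bs where "xs = as @ p # bs"
      by blast
    moreover have "?c' (as @ p # bs) = (-1) ^ length as * ?c' (p # as @ bs)"
      using c' by (intro alternating_move) (auto simp: cycles_iff oriented_chains_iff)
    ultimately show ?thesis
      using \<open>\<And>xs. ?c' (p # xs) = 0\<close> by simp
  qed
  have qc': "cone_chain q ?c' \<in> oriented_chains (i + 1 + 1) K"
  proof (rule cone_in_chains)
    show "?c' \<in> oriented_chains (i + 1) K"
      using c' by (simp add: cycles_iff)
    fix xs assume xs: "?c' xs \<noteq> 0" "q \<notin> set xs"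
    then have "set xs \<in> K" "p \<notin> set xs"
      using chain_support[OF \<open>?c' \<in> oriented_chains (i + 1) K\<close>] no_p by blast+
    then have "set xs \<in> L"
      using xs(2) by (auto simp: suspension_def)
    then show "insert q (set xs) \<in> K"
      by (simp add: suspension_def)
  qed
  have "chain_boundary_map K (cone_chain q ?c') = ?c'"
    using c' by (simp add: boundary_cone_chain_cycle)
  \<comment> \<open>Undoing the correction: \<open>?c'\<close> bounds its cone over
    \<open>q\<close>, and subtracting the boundary of \<open>cone_chain p b\<close> gives back
    \<open>c\<close>.\<close>
  then have "chain_boundary_map K (\<lambda>xs. cone_chain q ?c' xs - cone_chain p b xs) = c"
    by (simp add: boundary_diff)
  then show "c \<in> simplicial_boundaries (i + 1) K"
    unfolding simplicial_boundaries_def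
    by (rule image_eqI[OF sym oriented_chains_diff[OF qc' pb]])
qed (rule desuspend_boundaries)

text \<open>Exactness moves from degree \<open>i - 1\<close> of \<open>L\<close> to degree
  \<open>i\<close> of \<open>K\<close>, and \<open>\<psi>\<close> is precomposed with taking the
  part at \<open>p\<close>.\<close>

lemma has_homology_of_sphere_suspension:
  assumes m: "m \<ge> -1" and L: "has_homology_of_sphere m L"
  shows "has_homology_of_sphere (m + 1) K"
proof -
  obtain \<psi> where ex: "\<And>i. i \<noteq> m \<Longrightarrow> simplicial_cycles i L = simplicial_boundaries i L"
    and \<psi>: "infinite_cyclic_homology m L \<psi>"
    using L has_homology_of_sphere_iff[OF complex m] by auto
  have "simplicial_cycles i K = simplicial_boundaries i K" if "i \<noteq> m + 1" for i
  proof -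
    have "c \<in> simplicial_boundaries i K" if "c \<in> simplicial_cycles i K" for c
      using that ex[of "i - 1"] \<open>i \<noteq> m + 1\<close> desuspend_cycle[of c "i - 1"]
        desuspend_boundaries_iff[of c "i - 1"] by simp
    then show ?thesis
      using boundaries_subset_cycles[OF simplicial_complex_suspension] by blast
  qed
  moreover have "infinite_cyclic_homology (m + 1) K (\<lambda>c. \<psi> (\<lambda>xs. c (p # xs)))"
  proof -
    have "\<exists>c\<in>simplicial_cycles (m + 1) K. k = \<psi> (\<lambda>xs. c (p # xs))" for k
    proof -
      have "k \<in> \<psi> ` simplicial_cycles m L"
        using \<psi> by (simp add: infinite_cyclic_homology_def)
      then obtain z where z: "z \<in> simplicial_cycles m L" "k = \<psi> z"
        by blast
      obtain c where "c \<in> simplicial_cycles (m + 1) K" "(\<lambda>xs. c (p # xs)) = z"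
        by (rule desuspend_cycle_surj[OF z(1)])
      then show ?thesis using z(2) by blast
    qed
    then show ?thesis
      using \<psi> desuspend_cycle[of _ m] desuspend_boundaries_iff[of _ m]
      unfolding infinite_cyclic_homology_def by (auto simp: image_iff)
  qed
  ultimately show ?thesis
    using m by (subst has_homology_of_sphere_iff[OF simplicial_complex_suspension]) auto
qed

end

section \<open>Euler characteristics\<close>

text \<open>Reduction modulo 2. Working with the images of integral chains under
  \<open>parity\<close> avoids a second chain complex with coefficients in the field of two
  elements.\<close>

definition parity :: "('a list \<Rightarrow> int) \<Rightarrow> 'a list \<Rightarrow> bool" where
  "parity c = (\<lambda>xs. odd (c xs))"

lemma parity_eqD:
  assumes "parity c = parity d"
  obtains e where "c = (\<lambda>xs. d xs + 2 * e xs)"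
proof
  show "c = (\<lambda>xs. d xs + 2 * ((c xs - d xs) div 2))"
  proof
    fix xs
    have "odd (c xs) \<longleftrightarrow> odd (d xs)"
      using fun_cong[OF assms, of xs] by (simp add: parity_def)
    then show "c xs = d xs + 2 * ((c xs - d xs) div 2)" by simp
  qed
qed

lemma halve_chain:
  assumes "(\<lambda>xs. 2 * e xs) \<in> oriented_chains i L"
  shows "e \<in> oriented_chains i L"
proof -
  have "e (xs @ y # x # ys) = - e (xs @ x # y # ys)" for xs x y ys
    using alternatingD[OF chain_alternating[OF assms], of xs y x ys] by simp
  then have "alternating e"
    unfolding alternating_def by (intro allI)
  then show ?thesis
    using assms by (simp add: oriented_chains_iff)
qed

text \<open>The integers have no 2-torsion, so the factor 2 can be cancelled in the cycle
  condition.\<close>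

lemma halve_cycle:
  assumes "(\<lambda>xs. 2 * e xs) \<in> simplicial_cycles i L"
  shows "e \<in> simplicial_cycles i L"
proof -
  have "chain_boundary_map L (\<lambda>xs. 2 * e xs) = (\<lambda>xs. 0)"
    using assms by (simp add: cycles_iff)
  then show ?thesis
    using assms halve_chain by (auto simp: cycles_iff boundary_scale fun_eq_iff)
qed

text \<open>An orientation of the simplex, built by coning one vertex after another. Of its values
  only oddness is recorded, which is all that counting modulo 2 requires.\<close>

lemma simplex_chain_exists:
  assumes "finite \<sigma>"
  shows "\<exists>c. alternating c \<and> (\<forall>xs. c xs \<noteq> 0 \<longleftrightarrow> distinct xs \<and> set xs = \<sigma>) \<and> (\<forall>xs. c xs \<noteq> 0 \<longrightarrow> odd (c xs))"
  using assms
proof (induction \<sigma>)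
  case empty
  show ?case
    by (rule exI[of _ "\<lambda>xs. if xs = [] then 1 else 0"]) (simp add: alternating_def)
next
  case (insert p \<sigma>)
  from insert.IH obtain c where c: "alternating c" "\<forall>xs. c xs \<noteq> 0 \<longleftrightarrow> distinct xs \<and> set xs = \<sigma>"
    "\<forall>xs. c xs \<noteq> 0 \<longrightarrow> odd (c xs)"
    by (elim exE conjE)
  have "cone_chain p c xs \<noteq> 0 \<longleftrightarrow> distinct xs \<and> p \<in> set xs \<and> c (remove1 p xs) \<noteq> 0" for xs
    by (auto simp: cone_chain_def)
  moreover have "distinct xs \<and> p \<in> set xs \<and> c (remove1 p xs) \<noteq> 0 \<longleftrightarrow> distinct xs \<and> set xs = insert p \<sigma>" for xs
    using insert.hyps spec[OF c(2), of "remove1 p xs"] by auto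
  moreover have "odd (cone_chain p c xs)" if "cone_chain p c xs \<noteq> 0" for xs
    using that spec[OF c(3), of "remove1 p xs"] by (auto simp: cone_chain_def split: if_splits)
  ultimately show ?case
    by (intro exI[of _ "cone_chain p c"] conjI allI impI alternating_cone c(1)) simp_all
qed

lemma alternating_sum:
  assumes "\<And>x. x \<in> A \<Longrightarrow> alternating (c x)"
  shows "alternating (\<lambda>xs. \<Sum>x\<in>A. c x xs)"
  unfolding alternating_def sum_negf[symmetric]
proof (intro allI sum.cong refl)
  fix xs x y ys a
  assume "a \<in> A"
  then show "c a (xs @ y # x # ys) = - c a (xs @ x # y # ys)"
    by (rule alternatingD[OF assms])
qed

text \<open>Signs disappear modulo 2, so a reduced chain is the same as a set of
  \<open>i\<close>-simplices, namely those with odd coefficient.\<close>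

lemma parity_chains:
  assumes L: "simplicial_complex L"
  shows "parity ` oriented_chains i L = (\<lambda>T xs. distinct xs \<and> set xs \<in> T) ` Pow {\<sigma> \<in> L. int (card \<sigma>) = i + 1}"
    (is "_ = ?g ` Pow ?L")
proof
  show "parity ` oriented_chains i L \<subseteq> ?g ` Pow ?L"
  proof
    fix u assume "u \<in> parity ` oriented_chains i L"
    then obtain c where c: "c \<in> oriented_chains i L" "u = parity c" by blast
    define T where "T = {\<sigma> \<in> ?L. \<exists>xs. distinct xs \<and> set xs = \<sigma> \<and> odd (c xs)}"
    have "odd (c xs) \<longleftrightarrow> distinct xs \<and> set xs \<in> T" for xs
    proof
      assume odd: "odd (c xs)"
      then have "c xs \<noteq> 0" by auto
      then have "distinct xs" "set xs \<in> L" "int (length xs) = i + 1"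
        using c by (auto simp: oriented_chains_iff)
      then show "distinct xs \<and> set xs \<in> T"
        using odd by (auto simp: T_def distinct_card)
    next
      assume xs: "distinct xs \<and> set xs \<in> T"
      then obtain ys where "distinct ys" "set ys = set xs" "odd (c ys)"
        by (auto simp: T_def)
      moreover have "mset ys = mset xs"
        using calculation(1,2) xs set_eq_iff_mset_eq_distinct[of ys xs] by simp
      then have "\<bar>c ys\<bar> = \<bar>c xs\<bar>"
        by (rule alternating_abs_perm[OF chain_alternating[OF c(1)]])
      ultimately show "odd (c xs)"
        using dvd_abs_iff[of 2 "c xs"] dvd_abs_iff[of 2 "c ys"] by simp
    qed
    then have "u = ?g T"
      using c(2) by (simp add: parity_def)
    moreover have "T \<in> Pow ?L"
      unfolding T_def by blast
    ultimately show "u \<in> ?g ` Pow ?L"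
      by (rule image_eqI)
  qed
next
  show "?g ` Pow ?L \<subseteq> parity ` oriented_chains i L"
  proof
    fix u assume "u \<in> ?g ` Pow ?L"
    then obtain T where T: "T \<subseteq> ?L" "u = ?g T" by blast
    have fin: "finite T" "\<And>\<sigma>. \<sigma> \<in> T \<Longrightarrow> finite \<sigma>"
      using T(1) L by (auto simp: simplicial_complex_def intro: finite_subset)
    have "\<forall>\<sigma>\<in>T. \<exists>c. alternating c \<and> (\<forall>xs. c xs \<noteq> 0 \<longleftrightarrow> distinct xs \<and> set xs = \<sigma>) \<and>
        (\<forall>xs. c xs \<noteq> 0 \<longrightarrow> odd (c xs))"
      using simplex_chain_exists fin(2) by blast
    from bchoice[OF this] obtain e where choice: "\<forall>\<sigma>\<in>T. alternating (e \<sigma>) \<and>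
        (\<forall>xs. e \<sigma> xs \<noteq> 0 \<longleftrightarrow> distinct xs \<and> set xs = \<sigma>) \<and> (\<forall>xs. e \<sigma> xs \<noteq> 0 \<longrightarrow> odd (e \<sigma> xs))"
      by (elim exE)
    have e: "alternating (e \<sigma>)" "e \<sigma> xs \<noteq> 0 \<longleftrightarrow> distinct xs \<and> set xs = \<sigma>"
      "e \<sigma> xs \<noteq> 0 \<Longrightarrow> odd (e \<sigma> xs)" if "\<sigma> \<in> T" for \<sigma> xs
      using bspec[OF choice that] by simp_all
    \<comment> \<open>The sum of the chosen orientations; at an ordering of a simplex in
      \<open>T\<close> only the summand of that simplex is nonzero.\<close>
    define c where "c = (\<lambda>xs. \<Sum>\<sigma>\<in>T. e \<sigma> xs)"
    have c: "c xs = (if distinct xs \<and> set xs \<in> T then e (set xs) xs else 0)" for xs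
    proof (cases "distinct xs \<and> set xs \<in> T")
      case True
      then have "c xs = (\<Sum>\<sigma>\<in>{set xs}. e \<sigma> xs)"
        unfolding c_def using fin e(2) by (intro sum.mono_neutral_right) auto
      then show ?thesis using True by simp
    next
      case False
      then have "e \<sigma> xs = 0" if "\<sigma> \<in> T" for \<sigma>
        using that e(2)[of \<sigma> xs] by auto
      then show ?thesis
        using False by (auto simp: c_def)
    qed
    have "alternating c"
      unfolding c_def by (intro alternating_sum e(1))
    then have "c \<in> oriented_chains i L"
      using T(1) unfolding oriented_chains_iff c by (auto simp: distinct_card split: if_splits)
    moreover have "u = parity c"
      using e(2,3) by (auto simp: T(2) parity_def c fun_eq_iff)
    ultimately show "u \<in> parity ` oriented_chains i L" by blast
  qed
qed

text \<open>Every simplex has an ordering, so different sets of simplices give different reduced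
  chains, and it remains to count subsets.\<close>

lemma card_parity_chains:
  assumes L: "simplicial_complex L"
  shows "card (parity ` oriented_chains i L) = 2 ^ card {\<sigma> \<in> L. int (card \<sigma>) = i + 1}"
    and "finite (parity ` oriented_chains i L)"
proof -
  let ?L = "{\<sigma> \<in> L. int (card \<sigma>) = i + 1}"
  have fin: "finite ?L" "\<And>\<sigma>. \<sigma> \<in> ?L \<Longrightarrow> finite \<sigma>"
    using L by (auto simp: simplicial_complex_def)
  have sub: "S \<subseteq> T" if S: "S \<subseteq> ?L"
    and eq: "(\<lambda>xs. distinct xs \<and> set xs \<in> S) = (\<lambda>xs. distinct xs \<and> set xs \<in> T)" for S T
  proof
    fix \<sigma> assume "\<sigma> \<in> S"
    then obtain xs where "set xs = \<sigma>" "distinct xs"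
      using finite_distinct_list[of \<sigma>] fin(2) S by blast
    then show "\<sigma> \<in> T"
      using fun_cong[OF eq, of xs] \<open>\<sigma> \<in> S\<close> by simp
  qed
  have "inj_on (\<lambda>T xs. distinct xs \<and> set xs \<in> T) (Pow ?L)"
  proof (rule inj_onI)
    fix S T
    assume "S \<in> Pow ?L" "T \<in> Pow ?L"
      and eq: "(\<lambda>xs. distinct xs \<and> set xs \<in> S) = (\<lambda>xs. distinct xs \<and> set xs \<in> T)"
    then have "S \<subseteq> ?L" "T \<subseteq> ?L" by blast+
    then show "S = T"
      using sub[OF _ eq] sub[OF _ eq[symmetric]] by (intro equalityI)
  qed
  then show "card (parity ` oriented_chains i L) = 2 ^ card ?L"
    using fin(1) by (simp add: parity_chains[OF L] card_image card_Pow)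
  show "finite (parity ` oriented_chains i L)"
    using fin(1) by (simp add: parity_chains[OF L])
qed

lemma card_eq_mult_card_image:
  assumes "finite A" "\<And>y. y \<in> f ` A \<Longrightarrow> card {x \<in> A. f x = y} = k"
  shows "card A = k * card (f ` A)"
proof -
  have "card A = (\<Sum>y\<in>f ` A. card {x \<in> A. f x = y})"
    using sum.image_gen[OF assms(1), of "\<lambda>x. 1 :: nat" f] by simp
  then show ?thesis
    using assms(2) by simp
qed

text \<open>The right-hand side depends on \<open>c\<close> only through \<open>parity c\<close>:
  the boundary map descends to reduced chains.\<close>

lemma parity_boundary:
  assumes "simplicial_complex L"
  shows "parity (chain_boundary_map L c) = (\<lambda>xs. odd (card {v \<in> \<Union>L. parity c (v # xs)}))"
  using simplicial_complex_finite_vertices[OF assms]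
  by (simp add: parity_def chain_boundary_map_def even_sum_iff fun_eq_iff)

text \<open>Exactness in degree \<open>i - 1\<close> lets a chain with even boundary be corrected, modulo 2, to a cycle.\<close>

lemma chain_with_even_boundary:
  assumes L: "simplicial_complex L"
    and ex: "simplicial_cycles (i - 1) L = simplicial_boundaries (i - 1) L"
    and d: "d \<in> oriented_chains i L" and even: "chain_boundary_map L d = (\<lambda>xs. 2 * e xs)"
  obtains z where "z \<in> simplicial_cycles i L" "parity z = parity d"
proof -
  have "(\<lambda>xs. 2 * e xs) \<in> simplicial_cycles (i - 1) L"
    using chain_boundary_map_in_chains[OF L d] chain_boundary_map_twice[OF d]
    by (simp add: cycles_iff even)
  then have "e \<in> simplicial_boundaries (i - 1) L"
    using halve_cycle ex by blast
  then obtain b where b: "b \<in> oriented_chains i L" "e = chain_boundary_map L b"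
    by (auto simp: simplicial_boundaries_def)
  have "(\<lambda>xs. 2 * b xs) = (\<lambda>xs. b xs + b xs)"
    by auto
  then have "(\<lambda>xs. 2 * b xs) \<in> oriented_chains i L"
    using oriented_chains_closed(1)[OF b(1) b(1)] by simp
  \<comment> \<open>The boundary of \<open>2 * b\<close> is \<open>2 * e\<close>, so it cancels that
    of \<open>d\<close>, while the parity is unchanged.\<close>
  then have "(\<lambda>xs. d xs - 2 * b xs) \<in> simplicial_cycles i L"
    using d by (simp add: cycles_iff oriented_chains_diff boundary_diff boundary_scale even b(2))
  moreover have "parity (\<lambda>xs. d xs - 2 * b xs) = parity d"
    by (simp add: parity_def)
  ultimately show ?thesis by (rule that)
qed

text \<open>Rank-nullity modulo 2. The reduced boundary map \<open>f\<close> sends reduced chains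
  onto reduced cycles one degree lower, and each of its fibres is a translate of the reduced cycles
  in degree \<open>i\<close>.\<close>

lemma card_parity_exact:
  assumes L: "simplicial_complex L"
    and ex: "simplicial_cycles (i - 1) L = simplicial_boundaries (i - 1) L"
  shows "card (parity ` oriented_chains i L) =
    card (parity ` simplicial_cycles i L) * card (parity ` simplicial_cycles (i - 1) L)"
proof -
  define f :: "('a list \<Rightarrow> bool) \<Rightarrow> 'a list \<Rightarrow> bool"
    where "f u = (\<lambda>xs. odd (card {v \<in> \<Union>L. u (v # xs)}))" for u
  have f: "f (parity c) = parity (chain_boundary_map L c)" for c
    by (simp add: parity_boundary[OF L] f_def)
  have "f ` parity ` oriented_chains i L = parity ` chain_boundary_map L ` oriented_chains (i - 1 + 1) L"
    by (simp add: image_image f)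
  \<comment> \<open>Here exactness replaces the boundaries in degree \<open>i - 1\<close> by the
    cycles.\<close>
  then have im: "f ` parity ` oriented_chains i L = parity ` simplicial_cycles (i - 1) L"
    by (simp only: ex simplicial_boundaries_def)
  have "card {u \<in> parity ` oriented_chains i L. f u = y} = card (parity ` simplicial_cycles i L)"
    if y: "y \<in> f ` parity ` oriented_chains i L" for y
  proof -
    obtain c where c: "c \<in> oriented_chains i L" "y = f (parity c)"
      using y by blast
    \<comment> \<open>Translation by \<open>c\<close>: addition modulo 2 of truth values is
      \<open>\<noteq>\<close>.\<close>
    define s where "s u = (\<lambda>xs. u xs \<noteq> parity c xs)" for u
    have s: "s (parity z) = parity (\<lambda>xs. z xs + c xs)" for z
      by (auto simp: s_def parity_def fun_eq_iff)
    have "{u \<in> parity ` oriented_chains i L. f u = y} = s ` parity ` simplicial_cycles i L"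
    proof
      show "s ` parity ` simplicial_cycles i L \<subseteq> {u \<in> parity ` oriented_chains i L. f u = y}"
        using c by (auto simp: s f cycles_iff boundary_add oriented_chains_closed)
      show "{u \<in> parity ` oriented_chains i L. f u = y} \<subseteq> s ` parity ` simplicial_cycles i L"
      proof
        fix u assume "u \<in> {u \<in> parity ` oriented_chains i L. f u = y}"
        then obtain d where d: "d \<in> oriented_chains i L" "u = parity d" "f u = y" by blast
        then have "parity (chain_boundary_map L d) = parity (chain_boundary_map L c)"
          using c by (simp add: f)
        then obtain e where "chain_boundary_map L d = (\<lambda>xs. chain_boundary_map L c xs + 2 * e xs)"
          by (rule parity_eqD)
        \<comment> \<open>Two elements of a fibre differ by a chain with even boundary, which has
          the parity of an honest integral cycle.\<close>
        then have "chain_boundary_map L (\<lambda>xs. d xs - c xs) = (\<lambda>xs. 2 * e xs)"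
          by (simp add: boundary_diff)
        then obtain z where z: "z \<in> simplicial_cycles i L" "parity z = parity (\<lambda>xs. d xs - c xs)"
          by (rule chain_with_even_boundary[OF L ex oriented_chains_diff[OF d(1) c(1)]])
        have "u = s (parity z)"
          unfolding z(2) d(2) by (auto simp: s_def parity_def fun_eq_iff)
        then show "u \<in> s ` parity ` simplicial_cycles i L"
          using z(1) by blast
      qed
    qed
    moreover have "inj_on s (parity ` simplicial_cycles i L)"
      by (rule inj_onI) (auto simp: s_def fun_eq_iff)
    ultimately show ?thesis
      by (simp add: card_image)
  qed
  then have "card (parity ` oriented_chains i L) =
      card (parity ` simplicial_cycles i L) * card (f ` parity ` oriented_chains i L)"
    by (rule card_eq_mult_card_image[OF card_parity_chains(2)[OF L]])
  then show ?thesis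
    by (simp only: im)
qed

text \<open>Without boundaries, \<open>\<psi>\<close> identifies the cycles with the integers, and
  the reduction of a cycle is decided by the parity of its image.\<close>

lemma card_parity_infinite_cyclic:
  assumes \<psi>: "infinite_cyclic_homology i L \<psi>" and B: "simplicial_boundaries i L = {\<lambda>xs. 0}"
  shows "card (parity ` simplicial_cycles i L) = 2"
proof -
  have add: "\<psi> (\<lambda>xs. c xs + d xs) = \<psi> c + \<psi> d"
    if "c \<in> simplicial_cycles i L" "d \<in> simplicial_cycles i L" for c d
    using \<psi> that by (simp add: infinite_cyclic_homology_def)
  have surj: "\<exists>c\<in>simplicial_cycles i L. \<psi> c = k" for k
  proof -
    have "k \<in> \<psi> ` simplicial_cycles i L"
      using \<psi> by (simp add: infinite_cyclic_homology_def)
    then show ?thesis by blast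
  qed
  have inj: "c = d" if cd: "c \<in> simplicial_cycles i L" "d \<in> simplicial_cycles i L" "\<psi> c = \<psi> d" for c d
  proof -
    have mem: "(\<lambda>xs. c xs - d xs) \<in> simplicial_cycles i L"
      using cd by (intro cycles_diff)
    have "\<psi> c = \<psi> (\<lambda>xs. c xs - d xs) + \<psi> d"
      using add[OF mem cd(2)] by simp
    then have "(\<lambda>xs. c xs - d xs) = (\<lambda>xs. 0)"
      using \<psi> mem B cd(3) by (simp add: infinite_cyclic_homology_def)
    then show ?thesis by (simp add: fun_eq_iff)
  qed
  obtain z where z: "z \<in> simplicial_cycles i L" "\<psi> z = 1"
    using surj by blast
  have double: "(\<lambda>xs. y xs + y xs) \<in> simplicial_cycles i L" "\<psi> (\<lambda>xs. y xs + y xs) = 2 * \<psi> y"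
    if "y \<in> simplicial_cycles i L" for y
    using cycles_add[OF that that] add[OF that that] by simp_all
  have "\<psi> (\<lambda>xs. 0) = 0"
    using add[OF zero_cycle zero_cycle] by simp
  have "parity c \<in> {parity (\<lambda>xs. 0), parity z}" if c: "c \<in> simplicial_cycles i L" for c
  proof -
    \<comment> \<open>With \<open>y\<close> over half of \<open>\<psi> c\<close>, rounded down,
      injectivity gives \<open>c = 2 y\<close> or \<open>c = z + 2 y\<close>.\<close>
    obtain y where y: "y \<in> simplicial_cycles i L" "\<psi> y = \<psi> c div 2"
      using surj by blast
    show ?thesis
    proof (cases "even (\<psi> c)")
      case True
      then have "c = (\<lambda>xs. y xs + y xs)"
        using inj[OF c double(1)[OF y(1)]] double(2)[OF y(1)] y(2) by simp
      then show ?thesis by (simp add: parity_def)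
    next
      case False
      have mem: "(\<lambda>xs. z xs + (y xs + y xs)) \<in> simplicial_cycles i L"
        by (rule cycles_add[OF z(1) double(1)[OF y(1)]])
      have "\<psi> c = 1 + 2 * \<psi> y"
        using False y(2) by presburger
      then have "c = (\<lambda>xs. z xs + (y xs + y xs))"
        using inj[OF c mem] add[OF z(1) double(1)[OF y(1)]] double(2)[OF y(1)] z(2) by simp
      then show ?thesis by (simp add: parity_def)
    qed
  qed
  \<comment> \<open>Otherwise \<open>z\<close> would be twice a cycle, making
    \<open>\<psi> z = 1\<close> even.\<close>
  moreover have "parity z \<noteq> parity (\<lambda>xs. 0)"
  proof
    assume "parity z = parity (\<lambda>xs. 0)"
    then obtain e where e: "z = (\<lambda>xs. 0 + 2 * e xs)"
      by (rule parity_eqD)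
    then have "e \<in> simplicial_cycles i L"
      using z(1) halve_cycle[of e i L] by simp
    moreover have "z = (\<lambda>xs. e xs + e xs)"
      using e by auto
    ultimately have "\<psi> z = 2 * \<psi> e"
      using double(2) by simp
    then show False
      using z(2) by presburger
  qed
  ultimately have "parity ` simplicial_cycles i L = {parity (\<lambda>xs. 0), parity z}"
    using z(1) zero_cycle[of i L] by blast
  then show ?thesis
    using \<open>parity z \<noteq> parity (\<lambda>xs. 0)\<close> by simp
qed

section \<open>From exactness modulo 2 to the Euler characteristic\<close>

lemma cycles_subset_chains: "simplicial_cycles i L \<subseteq> oriented_chains i L"
  by (auto simp: cycles_iff)

lemma chains_trivial:
  assumes "\<And>\<sigma>. \<sigma> \<in> L \<Longrightarrow> int (card \<sigma>) \<noteq> i + 1"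
  shows "oriented_chains i L = {\<lambda>xs. 0}"
proof -
  have "c = (\<lambda>xs. 0)" if "c \<in> oriented_chains i L" for c
  proof
    fix xs
    have "c xs \<noteq> 0 \<longrightarrow> distinct xs \<and> set xs \<in> L \<and> int (length xs) = i + 1"
      using that by (simp add: oriented_chains_iff)
    then show "c xs = 0"
      using assms[of "set xs"] distinct_card[of xs] by auto
  qed
  then show ?thesis
    using zero_chain by blast
qed

lemma simplicial_dim_iff:
  assumes "simplicial_complex L"
  shows "simplicial_dim L = m \<longleftrightarrow>
    (\<forall>\<sigma>\<in>L. int (card \<sigma>) \<le> m + 1) \<and> (\<exists>\<sigma>\<in>L. int (card \<sigma>) = m + 1)"
proof -
  have "finite L" "L \<noteq> {}"
    using assms by (auto simp: simplicial_complex_def)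
  then have "simplicial_dim L = m \<longleftrightarrow>
      m \<in> (\<lambda>\<sigma>. int (card \<sigma>) - 1) ` L \<and> (\<forall>x\<in>(\<lambda>\<sigma>. int (card \<sigma>) - 1) ` L. x \<le> m)"
    unfolding simplicial_dim_def by (subst Max_eq_iff) auto
  moreover have "m = x - 1 \<longleftrightarrow> x = m + 1" "x - 1 \<le> m \<longleftrightarrow> x \<le> m + 1" for x
    by auto
  ultimately show ?thesis
    by (simp add: image_iff) blast
qed

text \<open>Each face number \<open>F k\<close> is a sum of two consecutive ranks \<open>l\<close>
  of reduced cycles, so the alternating sum telescopes to the top rank, which is 1. The case
  \<open>n = 0\<close> is the complex \<open>{{}}\<close>.\<close>

lemma euler_characteristic_sphere:
  assumes L: "simplicial_complex L" and dim: "simplicial_dim L = int n - 1"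
    and hom: "has_homology_of_sphere (int n - 1) L"
  shows "(\<Sum>\<sigma>\<in>L. (-1) ^ card \<sigma>) = ((-1) ^ n :: real)"
proof -
  define F where "F k = card {\<sigma> \<in> L. card \<sigma> = k}" for k
  define l where "l i = log 2 (card (parity ` simplicial_cycles i L))" for i
  obtain \<psi> where ex: "\<And>i. i \<noteq> int n - 1 \<Longrightarrow> simplicial_cycles i L = simplicial_boundaries i L"
    and \<psi>: "infinite_cyclic_homology (int n - 1) L \<psi>"
    using hom has_homology_of_sphere_iff[OF L, of "int n - 1"] by auto
  have bound: "card \<sigma> \<le> n" if "\<sigma> \<in> L" for \<sigma>
    using dim that unfolding simplicial_dim_iff[OF L] by auto
  \<comment> \<open>There are no simplices above the top dimension, hence no boundaries in degree
    \<open>n - 1\<close>.\<close>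
  have "oriented_chains (int n) L = {\<lambda>xs. 0}"
    using bound by (intro chains_trivial) force
  then have "simplicial_boundaries (int n - 1) L = {\<lambda>xs. 0}"
    by (simp add: simplicial_boundaries_def boundary_zero)
  then have "l (int n - 1) = 1"
    using card_parity_infinite_cyclic[OF \<psi>] by (simp add: l_def)
  have "oriented_chains (-2) L = {\<lambda>xs. 0}"
    by (intro chains_trivial) auto
  then have "simplicial_cycles (-2) L = {\<lambda>xs. 0}"
    using zero_cycle[of "-2" L] cycles_subset_chains[of "-2" L] by blast
  then have "l (-2) = 0"
    by (simp add: l_def)
  \<comment> \<open>Exactness is needed in degree \<open>k - 2\<close>, which is below the
    exceptional degree \<open>n - 1\<close> for \<open>k \<le> n\<close>.\<close>
  have F: "F k = l (int k - 1) + l (int k - 2)" if "k \<le> n" for k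
  proof -
    have "{\<sigma> \<in> L. int (card \<sigma>) = int k - 1 + 1} = {\<sigma> \<in> L. card \<sigma> = k}"
      by auto
    then have "2 ^ F k = card (parity ` simplicial_cycles (int k - 1) L) * card (parity ` simplicial_cycles (int k - 1 - 1) L)"
      using card_parity_exact[OF L ex, of "int k - 1"] that card_parity_chains(1)[OF L, of "int k - 1"]
      by (simp add: F_def)
    moreover have "int k - 1 - 1 = int k - 2" by simp
    ultimately have eq: "2 ^ F k = card (parity ` simplicial_cycles (int k - 1) L) * card (parity ` simplicial_cycles (int k - 2) L)"
      by simp
    \<comment> \<open>The product is a power of 2, so both factors are positive, as
      \<open>log_mult\<close> requires.\<close>
    then have pos: "card (parity ` simplicial_cycles (int k - 1) L) > 0" "card (parity ` simplicial_cycles (int k - 2) L) > 0"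
      by (metis (lifting) nat_0_less_mult_iff zero_less_numeral zero_less_power)+
    have "real (F k) = log 2 (real (2 ^ F k))"
      by (simp add: log_nat_power)
    also have "\<dots> = l (int k - 1) + l (int k - 2)"
      unfolding eq l_def using pos by (simp add: log_mult)
    finally show ?thesis .
  qed
  have partial: "(\<Sum>k\<le>N. (-1) ^ k * real (F k)) = (-1) ^ N * l (int N - 1)" if "N \<le> n" for N
    using that
  proof (induction N)
    case 0
    then show ?case using F[of 0] \<open>l (-2) = 0\<close> by simp
  next
    case (Suc N)
    have "int (Suc N) - 2 = int N - 1" by simp
    then show ?case
      using Suc F[of "Suc N"] by (simp add: algebra_simps)
  qed
  have "finite L"
    using L by (simp add: simplicial_complex_def)
  have "(\<Sum>\<sigma>\<in>L. (-1) ^ card \<sigma>) = (\<Sum>k\<le>n. \<Sum>\<sigma>\<in>{\<sigma> \<in> L. card \<sigma> = k}. (-1) ^ card \<sigma> :: real)"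
    using bound by (intro sum.group[symmetric] \<open>finite L\<close>) auto
  also have "\<dots> = (\<Sum>k\<le>n. (-1) ^ k * real (F k))"
    by (intro sum.cong refl) (simp add: F_def)
  also have "\<dots> = (-1) ^ n"
    using partial[of n] \<open>l (int n - 1) = 1\<close> by simp
  finally show ?thesis .
qed

section \<open>Links\<close>

lemma simplicial_complex_subset: "simplicial_complex L \<Longrightarrow> \<sigma> \<in> L \<Longrightarrow> \<tau> \<subseteq> \<sigma> \<Longrightarrow> \<tau> \<in> L"
  by (auto simp: simplicial_complex_def)

lemma simplicial_complex_link:
  assumes L: "simplicial_complex L" and \<sigma>: "\<sigma> \<in> L"
  shows "simplicial_complex (link L \<sigma>)"
proof -
  have "\<rho> \<in> link L \<sigma>" if "\<tau> \<in> link L \<sigma>" "\<rho> \<subseteq> \<tau>" for \<rho> \<tau>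
    using that simplicial_complex_subset[OF L, of \<tau> \<rho>] simplicial_complex_subset[OF L, of "\<tau> \<union> \<sigma>" "\<rho> \<union> \<sigma>"]
    unfolding link_def by blast
  moreover have "finite (link L \<sigma>)" "{} \<in> link L \<sigma>" "\<forall>\<tau>\<in>link L \<sigma>. finite \<tau>"
    using L \<sigma> by (auto simp: link_def simplicial_complex_def)
  ultimately show ?thesis
    unfolding simplicial_complex_def by blast
qed

lemma link_link:
  assumes L: "simplicial_complex L" and \<tau>: "\<tau> \<in> link L \<sigma>"
  shows "link (link L \<sigma>) \<tau> = link L (\<tau> \<union> \<sigma>)"
proof -
  have "\<rho> \<in> link (link L \<sigma>) \<tau> \<longleftrightarrow> \<rho> \<in> link L (\<tau> \<union> \<sigma>)" for \<rho>
  proof -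
    have "\<rho> \<in> L \<and> \<rho> \<union> \<sigma> \<in> L \<and> \<rho> \<union> \<tau> \<in> L" if "\<rho> \<union> (\<tau> \<union> \<sigma>) \<in> L"
      by (intro conjI simplicial_complex_subset[OF L that]) auto
    moreover have "\<rho> \<union> \<tau> \<union> \<sigma> = \<rho> \<union> (\<tau> \<union> \<sigma>)" "\<tau> \<inter> \<sigma> = {}"
      using \<tau> by (auto simp: link_def)
    ultimately show ?thesis
      by (auto simp: link_def Int_Un_distrib Int_Un_distrib2)
  qed
  then show ?thesis by blast
qed

text \<open>A link inside a link is the link in \<open>L\<close> of the union, and the cardinalities
  of the two disjoint simplices add up.\<close>

lemma generalized_homology_sphere_link:
  assumes L: "generalized_homology_sphere m L" and \<sigma>: "\<sigma> \<in> L"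
  shows "generalized_homology_sphere (m - int (card \<sigma>)) (link L \<sigma>)"
proof -
  have complex: "simplicial_complex L"
    and links: "\<And>\<tau>. \<tau> \<in> L \<Longrightarrow> simplicial_dim (link L \<tau>) = m - int (card \<tau>) \<and>
      has_homology_of_sphere (m - int (card \<tau>)) (link L \<tau>)"
    using L by (auto simp: generalized_homology_sphere_def)
  have "link (link L \<sigma>) \<tau> = link L (\<tau> \<union> \<sigma>) \<and> \<tau> \<union> \<sigma> \<in> L \<and> card (\<tau> \<union> \<sigma>) = card \<tau> + card \<sigma>"
    if \<tau>: "\<tau> \<in> link L \<sigma>" for \<tau>
  proof -
    have "finite \<tau>" "finite \<sigma>" "\<tau> \<inter> \<sigma> = {}" "\<tau> \<union> \<sigma> \<in> L"
      using \<tau> \<sigma> complex by (auto simp: link_def simplicial_complex_def)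
    then show ?thesis
      using link_link[OF complex \<tau>] by (simp add: card_Un_disjoint)
  qed
  then have "simplicial_dim (link (link L \<sigma>) \<tau>) = m - int (card \<sigma>) - int (card \<tau>) \<and>
      has_homology_of_sphere (m - int (card \<sigma>) - int (card \<tau>)) (link (link L \<sigma>) \<tau>)"
    if "\<tau> \<in> link L \<sigma>" for \<tau>
    using that links[of "\<tau> \<union> \<sigma>"] by (simp add: algebra_simps)
  then show ?thesis
    using simplicial_complex_link[OF complex \<sigma>] links[OF \<sigma>]
    by (simp add: generalized_homology_sphere_def)
qed

section \<open>Flagness of links\<close>

lemma flag_complex_imp_complex: "flag_complex L \<Longrightarrow> simplicial_complex L"
  by (simp add: flag_complex_def)

lemma flag_complexD:
  assumes L: "flag_complex L" and S: "finite S" "S \<subseteq> \<Union>L"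
    and edges: "\<And>u v. u \<in> S \<Longrightarrow> v \<in> S \<Longrightarrow> u \<noteq> v \<Longrightarrow> {u, v} \<in> L"
  shows "S \<in> L"
proof (cases "S = {}")
  case True
  then show ?thesis
    using flag_complex_imp_complex[OF L] by (simp add: simplicial_complex_def)
next
  case False
  have "\<forall>S. finite S \<and> S \<noteq> {} \<and> S \<subseteq> \<Union>L \<and> (\<forall>u\<in>S. \<forall>v\<in>S. u \<noteq> v \<longrightarrow> {u, v} \<in> L) \<longrightarrow> S \<in> L"
    using L unfolding flag_complex_def by (rule conjunct2)
  then have "finite S \<and> S \<noteq> {} \<and> S \<subseteq> \<Union>L \<and> (\<forall>u\<in>S. \<forall>v\<in>S. u \<noteq> v \<longrightarrow> {u, v} \<in> L) \<longrightarrow> S \<in> L"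
    by (rule spec)
  then show ?thesis
    by (rule mp) (intro conjI ballI impI S False edges)
qed

lemma flag_complexI:
  assumes "simplicial_complex L"
    and "\<And>S. finite S \<Longrightarrow> S \<subseteq> \<Union>L \<Longrightarrow> \<forall>u\<in>S. \<forall>v\<in>S. u \<noteq> v \<longrightarrow> {u, v} \<in> L \<Longrightarrow> S \<in> L"
  shows "flag_complex L"
  unfolding flag_complex_def using assms(1) by (intro conjI allI impI assms(2)) simp_all

text \<open>If \<open>S\<close> is pairwise joined in the link, then
  \<open>S \<union> \<sigma>\<close> is pairwise joined in \<open>L\<close>, hence a simplex of
  \<open>L\<close>.\<close>

lemma flag_complex_link:
  assumes L: "flag_complex L" and \<sigma>: "\<sigma> \<in> L"
  shows "flag_complex (link L \<sigma>)"
proof -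
  have complex: "simplicial_complex L"
    by (rule flag_complex_imp_complex[OF L])
  have "S \<in> link L \<sigma>" if S: "finite S" "S \<subseteq> \<Union>(link L \<sigma>)"
    "\<forall>u\<in>S. \<forall>v\<in>S. u \<noteq> v \<longrightarrow> {u, v} \<in> link L \<sigma>" for S
  proof -
    have vertex: "v \<notin> \<sigma>" "v \<in> \<Union>L" "insert v \<sigma> \<in> L" if v: "v \<in> S" for v
    proof -
      obtain \<tau> where "v \<in> \<tau>" "\<tau> \<in> L" "\<tau> \<inter> \<sigma> = {}" "\<tau> \<union> \<sigma> \<in> L"
        using v S(2) by (auto simp: link_def)
      then show "v \<notin> \<sigma>" "v \<in> \<Union>L" "insert v \<sigma> \<in> L"
        using simplicial_complex_subset[OF complex, of "\<tau> \<union> \<sigma>" "insert v \<sigma>"] by auto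
    qed
    have edges: "{u, v} \<in> L" if uv: "u \<in> S \<union> \<sigma>" "v \<in> S \<union> \<sigma>" "u \<noteq> v" for u v
    proof -
      \<comment> \<open>An edge between \<open>S\<close> and \<open>\<sigma>\<close> lies in the
        simplex spanned by \<open>\<sigma>\<close> and one vertex of \<open>S\<close>.\<close>
      consider "u \<in> S" "v \<in> S" | "u \<in> S" "{u, v} \<subseteq> insert u \<sigma>" | "v \<in> S" "{u, v} \<subseteq> insert v \<sigma>" | "{u, v} \<subseteq> \<sigma>"
        using uv(1,2) by blast
      then show ?thesis
      proof cases
        case 1
        then show ?thesis using S(3) uv(3) by (auto simp: link_def)
      qed (use simplicial_complex_subset[OF complex] vertex(3) \<sigma> in blast)+
    qed
    have "finite (S \<union> \<sigma>)" "S \<union> \<sigma> \<subseteq> \<Union>L"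
      using vertex(2) \<sigma> S(1) complex by (auto simp: simplicial_complex_def)
    then have "S \<union> \<sigma> \<in> L"
      by (rule flag_complexD[OF L]) (rule edges)
    then show ?thesis
      using simplicial_complex_subset[OF complex, of "S \<union> \<sigma>" S] vertex(1) by (auto simp: link_def)
  qed
  then show ?thesis
    by (rule flag_complexI[OF simplicial_complex_link[OF complex \<sigma>]])
qed

text \<open>Removing \<open>\<tau>\<close> is a bijection from the simplices containing
  \<open>\<tau>\<close> onto its link.\<close>

lemma sum_over_star:
  assumes L: "simplicial_complex L" and \<tau>: "\<tau> \<in> L"
  shows "(\<Sum>\<sigma>\<in>{\<sigma> \<in> L. \<tau> \<subseteq> \<sigma>}. g (card \<sigma>)) = (\<Sum>\<rho>\<in>link L \<tau>. g (card \<rho> + card \<tau>))"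
proof (rule sum.reindex_bij_witness[of _ "\<lambda>\<rho>. \<rho> \<union> \<tau>" "\<lambda>\<sigma>. \<sigma> - \<tau>"])
  fix \<sigma> assume \<sigma>: "\<sigma> \<in> {\<sigma> \<in> L. \<tau> \<subseteq> \<sigma>}"
  then show "\<sigma> - \<tau> \<union> \<tau> = \<sigma>" by blast
  then show "\<sigma> - \<tau> \<in> link L \<tau>"
    using \<sigma> simplicial_complex_subset[OF L, of \<sigma> "\<sigma> - \<tau>"] by (auto simp: link_def)
  have "finite \<sigma>" "finite \<tau>"
    using \<sigma> \<tau> L by (auto simp: simplicial_complex_def)
  then have "card (\<sigma> - \<tau>) + card \<tau> = card \<sigma>"
    using \<sigma> by (simp add: card_Diff_subset card_mono)
  then show "g (card (\<sigma> - \<tau>) + card \<tau>) = g (card \<sigma>)" by simp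
qed (auto simp: link_def)

section \<open>Suspensions of flag homology spheres\<close>

context suspended_complex
begin

text \<open>Makes facts proved for the apex \<open>p\<close> available for \<open>q\<close>.\<close>

lemma suspended_complex_commute: "suspended_complex L q p"
  using complex p q pq by unfold_locales auto

lemma suspended_complex_link:
  assumes "\<sigma> \<in> L"
  shows "suspended_complex (link L \<sigma>) p q"
  using simplicial_complex_link[OF complex assms] p q pq
  by unfold_locales (auto simp: link_def)

text \<open>Each of the three kinds of simplices of the suspension is checked separately: those
  avoiding both apexes, those containing \<open>p\<close> and those containing
  \<open>q\<close>.\<close>

lemma link_suspension_base:
  assumes \<sigma>: "\<sigma> \<in> L"
  shows "link K \<sigma> = suspension p q (link L \<sigma>)"
proof -
  have p\<sigma>: "p \<notin> \<sigma>" and q\<sigma>: "q \<notin> \<sigma>"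
    using \<sigma> p q by auto
  have L_iff: "\<tau> \<in> K \<longleftrightarrow> \<tau> \<in> L" if "p \<notin> \<tau>" "q \<notin> \<tau>" for \<tau>
    using that by (auto simp: suspension_def)
  have base: "\<tau> \<in> link K \<sigma> \<longleftrightarrow> \<tau> \<in> link L \<sigma>" if "p \<notin> \<tau>" "q \<notin> \<tau>" for \<tau>
    using that p\<sigma> q\<sigma> by (simp add: link_def L_iff)
  have apex: "insert v \<tau> \<in> link K \<sigma> \<longleftrightarrow> \<tau> \<in> link L \<sigma>"
    if v: "v \<notin> \<tau>" "v \<notin> \<sigma>" "\<And>\<tau>. v \<notin> \<tau> \<Longrightarrow> insert v \<tau> \<in> K \<longleftrightarrow> \<tau> \<in> L" for v \<tau>
    using v(1,2) v(3)[of \<tau>] v(3)[of "\<tau> \<union> \<sigma>"] by (simp add: link_def)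
  note iff_p = insert_in_suspension_iff
  note iff_q = suspended_complex.insert_in_suspension_iff[OF suspended_complex_commute, unfolded suspension_commute[of q p]]
  have "\<tau> \<in> link K \<sigma> \<longleftrightarrow> \<tau> \<in> suspension p q (link L \<sigma>)" for \<tau>
  proof
    assume \<tau>: "\<tau> \<in> link K \<sigma>"
    then have "\<tau> \<in> K" by (simp add: link_def)
    then show "\<tau> \<in> suspension p q (link L \<sigma>)"
    proof (cases rule: in_suspension_cases)
      case 1
      then show ?thesis using \<tau> base by (simp add: suspension_def)
    next
      case (2 \<rho>)
      then show ?thesis
        using \<tau> apex[of p \<rho>] p\<sigma> iff_p by (simp add: suspension_def)
    next
      case (3 \<rho>)
      then show ?thesis
        using \<tau> apex[of q \<rho>] q\<sigma> iff_q by (simp add: suspension_def)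
    qed
  next
    interpret lk: suspended_complex "link L \<sigma>" p q
      by (rule suspended_complex_link[OF \<sigma>])
    assume "\<tau> \<in> suspension p q (link L \<sigma>)"
    then show "\<tau> \<in> link K \<sigma>"
    proof (cases rule: lk.in_suspension_cases)
      case 1
      then show ?thesis using base[of \<tau>] by simp
    next
      case (2 \<rho>)
      then show ?thesis using apex[of p \<rho>] p\<sigma> iff_p by simp
    next
      case (3 \<rho>)
      then show ?thesis using apex[of q \<rho>] q\<sigma> iff_q by simp
    qed
  qed
  then show ?thesis by blast
qed

lemma link_suspension_apex:
  assumes \<tau>: "\<tau> \<in> L"
  shows "link K (insert p \<tau>) = link L \<tau>"
proof -
  have "p \<notin> \<tau>" using \<tau> p by auto
  have "\<rho> \<in> link K (insert p \<tau>) \<longleftrightarrow> \<rho> \<in> link L \<tau>" for \<rho>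
  proof (cases "p \<in> \<rho>")
    case True
    then show ?thesis using p by (auto simp: link_def)
  next
    case False
    then have "\<rho> \<union> insert p \<tau> \<in> K \<longleftrightarrow> \<rho> \<union> \<tau> \<in> L"
      using insert_in_suspension_iff[of "\<rho> \<union> \<tau>"] \<open>p \<notin> \<tau>\<close> by simp
    moreover have "\<rho> \<in> L" "\<rho> \<in> K" if "\<rho> \<union> \<tau> \<in> L"
      using simplicial_complex_subset[OF complex that, of \<rho>] by (auto simp: suspension_def)
    ultimately show ?thesis
      using False unfolding link_def by auto
  qed
  then show ?thesis by blast
qed

lemma simplicial_dim_suspension: "simplicial_dim K = simplicial_dim L + 1"
proof -
  let ?m = "simplicial_dim L"
  have fin: "finite \<sigma>" if "\<sigma> \<in> L" for \<sigma>
    using complex that by (auto simp: simplicial_complex_def)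
  have dim: "\<forall>\<sigma>\<in>L. int (card \<sigma>) \<le> ?m + 1" "\<exists>\<sigma>\<in>L. int (card \<sigma>) = ?m + 1"
    using simplicial_dim_iff[OF complex, of ?m] by auto
  have "int (card \<sigma>) \<le> ?m + 1 + 1" if "\<sigma> \<in> K" for \<sigma>
    using that
  proof (cases rule: in_suspension_cases)
    case 1
    then show ?thesis using dim(1) by force
  next
    case (2 \<tau>)
    then show ?thesis using bspec[OF dim(1) 2(2)] fin[of \<tau>] by simp
  next
    case (3 \<tau>)
    then show ?thesis using bspec[OF dim(1) 3(2)] fin[of \<tau>] by simp
  qed
  moreover have "\<exists>\<sigma>\<in>K. int (card \<sigma>) = ?m + 1 + 1"
  proof -
    obtain \<sigma> where \<sigma>: "\<sigma> \<in> L" "int (card \<sigma>) = ?m + 1"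
      using dim(2) by blast
    then have "int (card (insert p \<sigma>)) = ?m + 1 + 1"
      using p fin[of \<sigma>] by auto
    then show ?thesis
      using \<sigma>(1) by (auto simp: suspension_def)
  qed
  ultimately show ?thesis
    unfolding simplicial_dim_iff[OF simplicial_complex_suspension] by blast
qed

text \<open>The link of a base simplex is a suspended sphere, so its dimension rises by one. The
  link of \<open>insert p \<tau>\<close> is that of \<open>\<tau>\<close> in \<open>L\<close>, and
  the extra vertex compensates for the shift of \<open>m\<close>.\<close>

lemma generalized_homology_sphere_suspension:
  assumes L: "generalized_homology_sphere m L"
  shows "generalized_homology_sphere (m + 1) K"
proof -
  have dim: "simplicial_dim L = m"
    and links: "\<And>\<tau>. \<tau> \<in> L \<Longrightarrow> simplicial_dim (link L \<tau>) = m - int (card \<tau>) \<and>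
      has_homology_of_sphere (m - int (card \<tau>)) (link L \<tau>)"
    using L by (auto simp: generalized_homology_sphere_def)
  have bound: "int (card \<sigma>) \<le> m + 1" if "\<sigma> \<in> L" for \<sigma>
    using dim that unfolding simplicial_dim_iff[OF complex] by blast
  have fin: "finite \<sigma>" if "\<sigma> \<in> L" for \<sigma>
    using complex that by (auto simp: simplicial_complex_def)
  have "simplicial_dim (link K \<sigma>) = m + 1 - int (card \<sigma>) \<and>
      has_homology_of_sphere (m + 1 - int (card \<sigma>)) (link K \<sigma>)" if "\<sigma> \<in> K" for \<sigma>
    using that
  proof (cases rule: in_suspension_cases)
    case 1
    interpret lk: suspended_complex "link L \<sigma>" p q
      by (rule suspended_complex_link[OF 1(1)])
    have shift: "m - int (card \<sigma>) + 1 = m + 1 - int (card \<sigma>)" by simp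
    \<comment> \<open>\<open>bound\<close> supplies \<open>m - int (card \<sigma>) \<ge> -1\<close>,
      so suspending the homology also covers the link \<open>{{}}\<close> of a maximal-dimensional
      simplex.\<close>
    then show ?thesis
      using links[OF 1(1)] bound[OF 1(1)] lk.simplicial_dim_suspension
        lk.has_homology_of_sphere_suspension[of "m - int (card \<sigma>)", unfolded shift]
      by (simp add: link_suspension_base[OF 1(1)])
  next
    case (2 \<tau>)
    then show ?thesis
      using links[of \<tau>] fin[of \<tau>] by (simp add: link_suspension_apex)
  next
    case (3 \<tau>)
    have "link K (insert q \<tau>) = link L \<tau>"
      using suspended_complex.link_suspension_apex[OF suspended_complex_commute 3(2)]
      by (simp only: suspension_commute[of q p])
    then show ?thesis
      using 3 links[of \<tau>] fin[of \<tau>] by simp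
  qed
  then show ?thesis
    using dim simplicial_complex_suspension simplicial_dim_suspension
    by (simp add: generalized_homology_sphere_def)
qed

text \<open>The apexes are not joined, so \<open>S\<close> contains at most one of them, and the
  rest of \<open>S\<close> is a simplex of \<open>L\<close> by flagness.\<close>

lemma flag_complex_suspension:
  assumes L: "flag_complex L"
  shows "flag_complex K"
proof -
  have "S \<in> K" if S: "finite S" "S \<subseteq> \<Union>K" "\<forall>u\<in>S. \<forall>v\<in>S. u \<noteq> v \<longrightarrow> {u, v} \<in> K" for S
  proof -
    let ?T = "S - {p, q}"
    have edges: "{u, v} \<in> L" if "u \<in> ?T" "v \<in> ?T" "u \<noteq> v" for u v
    proof -
      have "{u, v} \<in> K" "p \<notin> {u, v}" "q \<notin> {u, v}"
        using that S(3) by auto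
      then show ?thesis unfolding suspension_def by blast
    qed
    have "finite ?T" "?T \<subseteq> \<Union>L"
      using S(1,2) by (auto simp: vertices_suspension)
    then have "?T \<in> L"
      by (rule flag_complexD[OF L]) (rule edges)
    moreover have "\<not> (p \<in> S \<and> q \<in> S)"
    proof
      assume "p \<in> S \<and> q \<in> S"
      then have "{p, q} \<in> K" using S(3) pq by blast
      then have "{q} \<in> L"
        using insert_in_suspension_iff[of "{q}"] pq by simp
      then show False using q by blast
    qed
    then have "S = ?T \<or> S = insert p ?T \<or> S = insert q ?T"
      by blast
    ultimately show ?thesis
      unfolding suspension_def by (metis UnI1 UnI2 imageI)
  qed
  then show ?thesis
    by (rule flag_complexI[OF simplicial_complex_suspension])
qed

end

section \<open>Polynomial identities\<close>

lemma poly_f_poly: "poly (f_poly L) t = (\<Sum>\<sigma>\<in>L. t ^ card \<sigma>)"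
  by (simp add: f_poly_def poly_sum poly_monom)

text \<open>The suspension is the disjoint union of \<open>L\<close> and two shifted copies of
  \<open>L\<close>, each contributing \<open>t\<close> times the
  \<open>f\<close>-polynomial.\<close>

lemma (in suspended_complex) poly_f_poly_suspension:
  "poly (f_poly K) t = (1 + 2 * t) * poly (f_poly L) t"
proof -
  have fin: "finite L" "\<And>\<sigma>. \<sigma> \<in> L \<Longrightarrow> finite \<sigma>"
    using complex by (auto simp: simplicial_complex_def)
  have cone: "(\<Sum>\<sigma>\<in>insert v ` L. t ^ card \<sigma>) = t * (\<Sum>\<sigma>\<in>L. t ^ card \<sigma>)" if "v \<notin> \<Union>L" for v
  proof -
    have "inj_on (insert v) L"
      using that by (intro inj_onI) (metis Diff_insert_absorb UnionI)
    then have "(\<Sum>\<sigma>\<in>insert v ` L. t ^ card \<sigma>) = (\<Sum>\<sigma>\<in>L. t ^ card (insert v \<sigma>))"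
      by (simp add: sum.reindex)
    also have "\<dots> = (\<Sum>\<sigma>\<in>L. t * t ^ card \<sigma>)"
      using that fin by (intro sum.cong refl) auto
    finally show ?thesis by (simp add: sum_distrib_left)
  qed
  have "L \<inter> insert p ` L = {}" "(L \<union> insert p ` L) \<inter> insert q ` L = {}"
    using p q pq by blast+
  then have "(\<Sum>\<sigma>\<in>K. t ^ card \<sigma>) =
      (\<Sum>\<sigma>\<in>L. t ^ card \<sigma>) + (\<Sum>\<sigma>\<in>insert p ` L. t ^ card \<sigma>) + (\<Sum>\<sigma>\<in>insert q ` L. t ^ card \<sigma>)"
    using fin by (simp add: suspension_def sum.union_disjoint)
  then show ?thesis
    unfolding cone[OF p] cone[OF q] by (simp add: poly_f_poly algebra_simps)
qed

lemma (in suspended_complex) h_poly_suspension: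
  assumes dim: "simplicial_dim L = int n - 1"
  shows "h_poly K = [:1, 1:] * h_poly L"
proof (rule h_poly_unique[OF simplicial_complex_suspension, symmetric])
  fix t :: real assume t: "t > 0"
  have n: "nat (simplicial_dim L + 1) = n" "nat (simplicial_dim K + 1) = Suc n"
    using dim by (simp_all add: simplicial_dim_suspension)
  have "poly ([:1, 1:] * h_poly L) x = (1 + x) * poly (h_poly L) x" for x
    by (simp only: poly_mult) simp
  then have "(1 + t) ^ Suc n * poly ([:1, 1:] * h_poly L) (1 / (1 + t)) =
      ((1 + t) * (1 + 1 / (1 + t))) * ((1 + t) ^ n * poly (h_poly L) (1 / (1 + t)))"
    by (simp only: power_Suc mult_ac)
  \<comment> \<open>Both sides are \<open>t + 2\<close>: the factor \<open>1 + x\<close> of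
    \<open>h\<close> at \<open>x = 1 / (1 + t)\<close> matches the factor \<open>1 + 2 * x\<close>
    of \<open>f\<close> at \<open>x = 1 / t\<close>.\<close>
  also have "(1 + t) * (1 + 1 / (1 + t)) = t * (1 + 2 * (1 / t))"
    using t by (simp add: field_simps)
  also have "(1 + t) ^ n * poly (h_poly L) (1 / (1 + t)) = t ^ n * poly (f_poly L) (1 / t)"
    using h_poly_identity[OF complex, of t] t by (simp add: n)
  finally show "(1 + t) ^ nat (simplicial_dim K + 1) * poly ([:1, 1:] * h_poly L) (1 / (1 + t)) =
      t ^ nat (simplicial_dim K + 1) * poly (f_poly K) (1 / t)"
    by (simp add: n poly_f_poly_suspension mult_ac)
qed

section \<open>The Dehn-Sommerville relation for \<open>f\<close>-polynomials\<close>

lemma sum_Pow_power_card: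
  fixes t :: "'b::comm_semiring_1"
  assumes "finite \<sigma>"
  shows "(\<Sum>\<tau>\<in>Pow \<sigma>. t ^ card \<tau>) = (1 + t) ^ card \<sigma>"
  using assms
proof induction
  case (insert v \<sigma>)
  have "inj_on (insert v) (Pow \<sigma>)" "Pow \<sigma> \<inter> insert v ` Pow \<sigma> = {}"
    using insert.hyps by (auto simp: inj_on_def)
  then have "(\<Sum>\<tau>\<in>Pow (insert v \<sigma>). t ^ card \<tau>) =
      (\<Sum>\<tau>\<in>Pow \<sigma>. t ^ card \<tau>) + (\<Sum>\<tau>\<in>Pow \<sigma>. t ^ card (insert v \<tau>))"
    using insert.hyps by (simp add: Pow_insert sum.union_disjoint sum.reindex)
  also have "(\<Sum>\<tau>\<in>Pow \<sigma>. t ^ card (insert v \<tau>)) = (\<Sum>\<tau>\<in>Pow \<sigma>. t * t ^ card \<tau>)"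
  proof (intro sum.cong refl)
    fix \<tau> assume "\<tau> \<in> Pow \<sigma>"
    then have "finite \<tau>" "v \<notin> \<tau>"
      using insert.hyps by (auto intro: finite_subset)
    then show "t ^ card (insert v \<tau>) = t * t ^ card \<tau>" by simp
  qed
  finally show ?case
    using insert by (simp add: sum_distrib_left[symmetric] algebra_simps)
qed simp

text \<open>Expand \<open>(1 + t) ^ card \<sigma>\<close> over the faces \<open>\<tau>\<close> of
  \<open>\<sigma>\<close> and exchange the sums. The coefficient of \<open>t ^ card \<tau>\<close>
  is then a signed count over the star of \<open>\<tau>\<close>, given by the Euler characteristic
  of its link.\<close>

lemma dehn_sommerville_f_poly:
  assumes L: "generalized_homology_sphere (int n - 1) L"
  shows "poly (f_poly L) (- 1 - t) = (-1) ^ n * poly (f_poly L) t"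
proof -
  have complex: "simplicial_complex L" and dim: "simplicial_dim L = int n - 1"
    using L by (auto simp: generalized_homology_sphere_def)
  then have fin: "finite L" "\<And>\<sigma>. \<sigma> \<in> L \<Longrightarrow> finite \<sigma>"
    by (auto simp: simplicial_complex_def)
  have star: "(\<Sum>\<sigma>\<in>{\<sigma> \<in> L. \<tau> \<subseteq> \<sigma>}. (-1) ^ card \<sigma>) = ((-1) ^ n :: real)" if \<tau>: "\<tau> \<in> L" for \<tau>
  proof -
    have "int (card \<tau>) \<le> int n - 1 + 1"
      using dim \<tau> unfolding simplicial_dim_iff[OF complex] by blast
    then have n: "int n - 1 - int (card \<tau>) = int (n - card \<tau>) - 1" "n - card \<tau> + card \<tau> = n"
      by simp_all
    have "simplicial_dim (link L \<tau>) = int (n - card \<tau>) - 1"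
      "has_homology_of_sphere (int (n - card \<tau>) - 1) (link L \<tau>)"
      using L \<tau> by (auto simp: generalized_homology_sphere_def n(1)[symmetric])
    then have "(\<Sum>\<rho>\<in>link L \<tau>. (-1) ^ card \<rho>) = ((-1) ^ (n - card \<tau>) :: real)"
      by (rule euler_characteristic_sphere[OF simplicial_complex_link[OF complex \<tau>]])
    then have "(\<Sum>\<sigma>\<in>{\<sigma> \<in> L. \<tau> \<subseteq> \<sigma>}. (-1) ^ card \<sigma>) = ((-1) ^ (n - card \<tau>) * (-1) ^ card \<tau> :: real)"
      by (simp add: sum_over_star[OF complex \<tau>] power_add sum_distrib_right[symmetric])
    then show ?thesis
      by (simp only: power_add[symmetric] n(2))
  qed
  have "poly (f_poly L) (- 1 - t) = (\<Sum>\<sigma>\<in>L. (-1) ^ card \<sigma> * (1 + t) ^ card \<sigma>)"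
  proof -
    have "- 1 - t = (-1) * (1 + t)" by simp
    then show ?thesis
      by (simp only: poly_f_poly power_mult_distrib)
  qed
  also have "\<dots> = (\<Sum>\<sigma>\<in>L. \<Sum>\<tau>\<in>{\<tau> \<in> L. \<tau> \<subseteq> \<sigma>}. (-1) ^ card \<sigma> * t ^ card \<tau>)"
  proof (intro sum.cong refl)
    fix \<sigma> assume \<sigma>: "\<sigma> \<in> L"
    then have "{\<tau> \<in> L. \<tau> \<subseteq> \<sigma>} = Pow \<sigma>"
      using simplicial_complex_subset[OF complex] by blast
    then show "(-1) ^ card \<sigma> * (1 + t) ^ card \<sigma> = (\<Sum>\<tau>\<in>{\<tau> \<in> L. \<tau> \<subseteq> \<sigma>}. (-1) ^ card \<sigma> * t ^ card \<tau>)"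
      using sum_Pow_power_card[OF fin(2)[OF \<sigma>], of t] by (simp add: sum_distrib_left[symmetric])
  qed
  also have "\<dots> = (\<Sum>\<tau>\<in>L. \<Sum>\<sigma>\<in>{\<sigma> \<in> L. \<tau> \<subseteq> \<sigma>}. (-1) ^ card \<sigma> * t ^ card \<tau>)"
    by (rule sum.swap_restrict[OF fin(1) fin(1)])
  also have "\<dots> = (\<Sum>\<tau>\<in>L. (-1) ^ n * t ^ card \<tau>)"
    using star by (simp add: sum_distrib_right[symmetric])
  finally show ?thesis
    by (simp add: poly_f_poly sum_distrib_left)
qed

section \<open>Values and derivatives at \<open>-1\<close>\<close>

lemma poly_h_poly_minus_one:
  assumes "simplicial_complex L" "simplicial_dim L = int n - 1"
  shows "poly (h_poly L) (-1) = 2 ^ n * poly (f_poly L) (-1/2)"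
  using poly_h_poly[OF assms(1), of "-1"] assms(2) by simp

text \<open>Differentiating \<open>t ^ card \<sigma>\<close> gives one term
  \<open>t ^ (card \<sigma> - 1)\<close> per vertex of \<open>\<sigma>\<close>; regrouping by
  vertices produces the links.\<close>

lemma poly_pderiv_f_poly:
  assumes L: "simplicial_complex L"
  shows "poly (pderiv (f_poly L)) t = (\<Sum>v\<in>\<Union>L. poly (f_poly (link L {v})) t)"
proof -
  have fin: "finite L" "\<And>\<sigma>. \<sigma> \<in> L \<Longrightarrow> finite \<sigma>"
    using L by (auto simp: simplicial_complex_def)
  have "poly (pderiv (f_poly L)) t = (\<Sum>\<sigma>\<in>L. real (card \<sigma>) * t ^ (card \<sigma> - 1))"
    \<comment> \<open>At order 1 this is the additivity of \<open>pderiv\<close> over the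
      sum.\<close>
    using higher_pderiv_sum[of 1 "\<lambda>\<sigma>. monom (1 :: real) (card \<sigma>)" L]
    by (simp add: f_poly_def pderiv_monom poly_sum poly_monom)
  also have "\<dots> = (\<Sum>\<sigma>\<in>L. \<Sum>v\<in>{v \<in> \<Union>L. v \<in> \<sigma>}. t ^ (card \<sigma> - 1))"
  proof (intro sum.cong refl)
    fix \<sigma> assume "\<sigma> \<in> L"
    then have "{v \<in> \<Union>L. v \<in> \<sigma>} = \<sigma>" by blast
    then show "real (card \<sigma>) * t ^ (card \<sigma> - 1) = (\<Sum>v\<in>{v \<in> \<Union>L. v \<in> \<sigma>}. t ^ (card \<sigma> - 1))"
      by simp
  qed
  also have "\<dots> = (\<Sum>v\<in>\<Union>L. \<Sum>\<sigma>\<in>{\<sigma> \<in> L. v \<in> \<sigma>}. t ^ (card \<sigma> - 1))"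
    by (rule sum.swap_restrict[OF fin(1) simplicial_complex_finite_vertices[OF L]])
  also have "\<dots> = (\<Sum>v\<in>\<Union>L. poly (f_poly (link L {v})) t)"
  proof (intro sum.cong refl)
    fix v assume "v \<in> \<Union>L"
    then have "{v} \<in> L"
      using simplicial_complex_subset[OF L] by blast
    then show "(\<Sum>\<sigma>\<in>{\<sigma> \<in> L. v \<in> \<sigma>}. t ^ (card \<sigma> - 1)) = poly (f_poly (link L {v})) t"
      using sum_over_star[OF L, of "{v}" "\<lambda>k. t ^ (k - 1)"] by (simp add: poly_f_poly)
  qed
  finally show ?thesis .
qed

text \<open>With \<open>p = [:1, 1:] * q\<close>, the product rule at \<open>-1\<close> leaves only
  \<open>q\<close>.\<close>

lemma poly_div_linear_at_root:
  fixes p :: "real poly"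
  assumes "poly p (-1) = 0"
  shows "poly (p div [:1, 1:]) (-1) = poly (pderiv p) (-1)"
proof -
  have "[:1, 1:] dvd p"
    using assms poly_eq_0_iff_dvd[of p "-1"] by simp
  then obtain q where q: "p = [:1, 1:] * q" ..
  then have "p div [:1, 1:] = q"
    by (simp del: mult_pCons_left)
  moreover have "pderiv p = [:1, 1:] * pderiv q + q * pderiv [:1, 1:]"
    unfolding q by (rule pderiv_mult)
  ultimately show ?thesis
    by (simp add: pderiv_pCons)
qed

text \<open>At \<open>t = -1\<close> the inner function \<open>t / (1 - t)\<close> has value
  \<open>-1/2\<close> and derivative \<open>1/4\<close>; the term from differentiating
  \<open>(1 - t) ^ n\<close> carries the factor \<open>f(-1/2) = 0\<close>.\<close>

lemma poly_pderiv_h_poly_minus_one: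
  assumes L: "simplicial_complex L" and dim: "simplicial_dim L = int n - 1"
    and root: "poly (f_poly L) (-1/2) = 0"
  shows "poly (pderiv (h_poly L)) (-1) = 2 ^ n * poly (pderiv (f_poly L)) (-1/2) / 4"
proof -
  let ?g = "\<lambda>t. (1 - t) ^ n * poly (f_poly L) (t / (1 - t))"
  have deriv: "(?g has_field_derivative 2 ^ n * poly (pderiv (f_poly L)) (-1/2) / 4) (at (-1))"
    using root by (auto intro!: derivative_eq_intros DERIV_chain'[OF _ poly_DERIV] simp: field_simps)
  \<comment> \<open>The formula for \<open>h\<close> excludes \<open>t = 1\<close>, so it is used on
    an open set around \<open>-1\<close>.\<close>
  have eq: "?g t = poly (h_poly L) t" if "t \<in> {..<1}" for t
    using poly_h_poly[OF L, of t] that dim by simp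
  have "(poly (h_poly L) has_field_derivative 2 ^ n * poly (pderiv (f_poly L)) (-1/2) / 4) (at (-1))"
    by (rule has_field_derivative_transform_within_open[OF deriv, where S = "{..<1}"]) (simp_all add: eq)
  then show ?thesis
    by (rule DERIV_unique[OF poly_DERIV])
qed

text \<open>The factor 2 balances the powers: twice \<open>2 ^ n / 4\<close> is
  \<open>2 ^ (n - 1)\<close>, the factor relating \<open>h\<close> at \<open>-1\<close> to
  \<open>f\<close> at \<open>-1/2\<close> for a vertex link.\<close>

lemma h_tilde_eq_sum_links:
  assumes L: "generalized_homology_sphere (int n - 1) L" and "odd n"
  shows "2 * poly (h_tilde L) (-1) = (\<Sum>v\<in>\<Union>L. poly (h_poly (link L {v})) (-1))"
proof -
  have complex: "simplicial_complex L" and dim: "simplicial_dim L = int n - 1"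
    using L by (auto simp: generalized_homology_sphere_def)
  \<comment> \<open>The point \<open>-1/2\<close> is fixed by \<open>t \<mapsto> -1 - t\<close>, so
    for odd \<open>n\<close> the value equals its own negative.\<close>
  have root: "poly (f_poly L) (-1/2) = 0"
    using dehn_sommerville_f_poly[OF L, of "-1/2"] \<open>odd n\<close> by simp
  have "poly (h_poly L) (-1) = 0"
    using poly_h_poly_minus_one[OF complex dim] root by simp
  then have "2 * poly (h_tilde L) (-1) = 2 ^ n / 2 * poly (pderiv (f_poly L)) (-1/2)"
    by (simp add: h_tilde_def poly_div_linear_at_root poly_pderiv_h_poly_minus_one[OF complex dim root])
  also have "\<dots> = (\<Sum>v\<in>\<Union>L. 2 ^ (n - 1) * poly (f_poly (link L {v})) (-1/2))"
    using \<open>odd n\<close> by (cases n) (simp_all add: poly_pderiv_f_poly[OF complex] sum_distrib_left)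
  also have "\<dots> = (\<Sum>v\<in>\<Union>L. poly (h_poly (link L {v})) (-1))"
  proof (intro sum.cong refl)
    fix v assume "v \<in> \<Union>L"
    then have v: "{v} \<in> L"
      using simplicial_complex_subset[OF complex] by blast
    then have "simplicial_dim (link L {v}) = int (n - 1) - 1"
      using generalized_homology_sphere_link[OF L v] \<open>odd n\<close>
      by (cases n) (simp_all add: generalized_homology_sphere_def)
    then show "2 ^ (n - 1) * poly (f_poly (link L {v})) (-1/2) = poly (h_poly (link L {v})) (-1)"
      by (simp add: poly_h_poly_minus_one[OF simplicial_complex_link[OF complex v]])
  qed
  finally show ?thesis .
qed

section \<open>The equivalence of the two conjectures\<close>

theorem mainTheorem1:
  shows "(\<forall>d::nat. d \<ge> 1 \<longrightarrow> (\<forall>L :: 'a::infinite set set.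
            flag_complex L \<and> generalized_homology_sphere (2 * int d - 1) L \<longrightarrow>
            (-1) ^ d * poly (h_poly L) (-1) \<ge> 0))
     \<longleftrightarrow> (\<forall>d::nat. d \<ge> 1 \<longrightarrow> (\<forall>L :: 'a set set.
            flag_complex L \<and> generalized_homology_sphere (2 * int d) L \<longrightarrow>
            (-1) ^ d * poly (h_tilde L) (-1) \<ge> 0))"
  (is "?A \<longleftrightarrow> ?B")
proof
  assume A: ?A
  show ?B
  proof (intro allI impI, elim conjE)
    fix d :: nat and L :: "'a set set"
    assume d: "d \<ge> 1" and flag: "flag_complex L" and L: "generalized_homology_sphere (2 * int d) L"
    have "0 \<le> (-1) ^ d * poly (h_poly (link L {v})) (-1)" if "v \<in> \<Union>L" for v
    proof -
      have v: "{v} \<in> L"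
        using that flag simplicial_complex_subset[of L] unfolding flag_complex_def by blast
      have "generalized_homology_sphere (2 * int d - 1) (link L {v})"
        using generalized_homology_sphere_link[OF L v] by simp
      then show ?thesis
        using A d flag_complex_link[OF flag v] by blast
    qed
    then have "0 \<le> (\<Sum>v\<in>\<Union>L. (-1) ^ d * poly (h_poly (link L {v})) (-1))"
      by (rule sum_nonneg)
    \<comment> \<open>Dimension \<open>2 * d\<close> corresponds to the odd number
      \<open>n = 2 * d + 1\<close>.\<close>
    also have "\<dots> = (-1) ^ d * (2 * poly (h_tilde L) (-1))"
      using h_tilde_eq_sum_links[of "2 * d + 1" L] L by (simp add: sum_distrib_left)
    finally show "0 \<le> (-1) ^ d * poly (h_tilde L) (-1)"
      by simp
  qed
next
  assume B: ?B
  show ?A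
  proof (intro allI impI, elim conjE)
    fix d :: nat and L :: "'a set set"
    assume d: "d \<ge> 1" and flag: "flag_complex L" and L: "generalized_homology_sphere (2 * int d - 1) L"
    have complex: "simplicial_complex L" and dim: "simplicial_dim L = int (2 * d) - 1"
      using L by (auto simp: generalized_homology_sphere_def)
    \<comment> \<open>The vertex type is infinite, so fresh apexes exist and the suspension stays on
      the same type, where \<open>?B\<close> applies.\<close>
    obtain p where p: "p \<notin> \<Union>L"
      using ex_new_if_finite[OF infinite_UNIV simplicial_complex_finite_vertices[OF complex]] by blast
    obtain q where q: "q \<notin> insert p (\<Union>L)"
      using ex_new_if_finite[OF infinite_UNIV, of "insert p (\<Union>L)"]
        simplicial_complex_finite_vertices[OF complex] by blast
    interpret suspended_complex L p q
      using complex p q by unfold_locales auto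
    have "generalized_homology_sphere (2 * int d) K"
      using generalized_homology_sphere_suspension[OF L] by simp
    then have "0 \<le> (-1) ^ d * poly (h_tilde K) (-1)"
      using B d flag_complex_suspension[OF flag] by blast
    then show "0 \<le> (-1) ^ d * poly (h_poly L) (-1)"
      by (simp add: h_tilde_unique[OF h_poly_suspension[OF dim]])
  qed
qed

end
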